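(* Let $p$ be a prime and $m\geq 2$ an integer, and let $U$, $D$ and $\mathcal{N}$ be as defined in the context. (i) Let $P$ be a non-abelian exponent-critical $p$-group of exponent $p^m$ and type $\mathcal{A}$. Then $P\cong U/N$ for some $N\in\mathcal{N}$. (ii) For every $N\in\mathcal{N}$, the group $U/N$ is a non-abelian exponent-critical $p$-group of exponent $p^m$. (iii) There are no non-abelian exponent-critical $2$-groups of exponent $2^2$ and type $\mathcal{A}$. When $p$ is odd or $m\geq 3$, every group of the form $U/N$ with $N\in\mathcal{N}$ is an exponent-critical $p$-group of exponent $p^m$ and type $\mathcal{A}$.
   Context: A finite group $G$ is exponent-critical if $\exp(G)$ is not the least common multiple of the exponents of the proper non-abelian subgroups of $G$. An exponent-critical $p$-group is of type $\mathcal{A}$ if it has exactly one abelian maximal subgroup. Construction: let $W=\langle a_0\rangle\times\langle a_1\rangle\times\cdots\times\langle a_{p-1}\rangle$ be abelian, where $a_0$ has order $p^m$ and $a_i$ has order $p^{m-1}$ for $1\le i\le p-1$. Let $\phi$ be the automorphism of $W$ with $\phi(a_i)=a_ia_{i+1}$ for $0\le i\le p-2$ and $\phi(a_{p-1})=a_{p-1}\prod_{j=1}^{p-1}a_j^{-\binom{p}{j}}$ (this automorphism has order $p$). Let $b_0$ generate a cyclic group of order $p^{m-1}$ and let $U=W\rtimes\langle b_0\rangle$ with $b_0^{-1}wb_0=\phi(w)$ for $w\in W$. Let $D$ be the normal subgroup of $U$ of order $p$ generated by $a_0^{p^{m-1}}a_{p-1}^{p^{m-2}}$. Let $\mathcal{N}$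 be the set of normal subgroups $N$ of $U$ such that $D\le N\le\Phi(U)$, $N\cap\langle a_0\rangle=\{1\}$, and $U'\not\le N$. *)

theory Defs
  imports "HOL-Algebra.Algebra"
begin

definition grp_exp :: "('a, 'b) monoid_scheme \<Rightarrow> 'a set \<Rightarrow> nat" where
  "grp_exp G H = Lcm (group.ord G ` H)"

definition abelian_set :: "('a, 'b) monoid_scheme \<Rightarrow> 'a set \<Rightarrow> bool" where
  "abelian_set G H \<longleftrightarrow> (\<forall>x\<in>H. \<forall>y\<in>H. x \<otimes>\<^bsub>G\<^esub> y = y \<otimes>\<^bsub>G\<^esub> x)"

definition exponent_critical :: "('a, 'b) monoid_scheme \<Rightarrow> bool" where
  "exponent_critical G \<longleftrightarrow> finite (carrier G) \<and>
     grp_exp G (carrier G) \<noteq>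
       Lcm {grp_exp G H | H. subgroup H G \<and> H \<noteq> carrier G \<and> \<not> abelian_set G H}"

definition p_group :: "nat \<Rightarrow> ('a, 'b) monoid_scheme \<Rightarrow> bool" where
  "p_group p G \<longleftrightarrow> group G \<and> finite (carrier G) \<and> (\<exists>k. card (carrier G) = p ^ k)"

definition maximal_subgroup :: "'a set \<Rightarrow> ('a, 'b) monoid_scheme \<Rightarrow> bool" where
  "maximal_subgroup H G \<longleftrightarrow> subgroup H G \<and> H \<noteq> carrier G \<and>
     (\<forall>K. subgroup K G \<and> H \<subseteq> K \<longrightarrow> K = H \<or> K = carrier G)"

definition type_A :: "('a, 'b) monoid_scheme \<Rightarrow> bool" where
  "type_A G \<longleftrightarrow> (\<exists>!H. maximal_subgroup H G \<and> abelian_set G H)"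

definition frattini :: "('a, 'b) monoid_scheme \<Rightarrow> 'a set" where
  "frattini G = carrier G \<inter> \<Inter> {H. maximal_subgroup H G}"

text \<open>Elements of W are written additively as coordinate vectors
  w = (w 0, ..., w (p-1)), i.e. the element a_0^(w 0) * ... * a_(p-1)^(w (p-1)),
  with w 0 reduced mod p^m and w i (1 <= i <= p-1) reduced mod p^(m-1);
  coordinates with index >= p are 0.\<close>

definition Wmod :: "nat \<Rightarrow> nat \<Rightarrow> nat \<Rightarrow> int" where
  "Wmod p m i = (if i = 0 then int p ^ m else int p ^ (m - 1))"

definition Wcarrier :: "nat \<Rightarrow> nat \<Rightarrow> (nat \<Rightarrow> int) set" where
  "Wcarrier p m = {w. \<forall>i. (i < p \<longrightarrow> 0 \<le> w i \<and> w i < Wmod p m i) \<and> (p \<le> i \<longrightarrow> w i = 0)}"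

definition Wplus :: "nat \<Rightarrow> nat \<Rightarrow> (nat \<Rightarrow> int) \<Rightarrow> (nat \<Rightarrow> int) \<Rightarrow> (nat \<Rightarrow> int)" where
  "Wplus p m v w = (\<lambda>i. if i < p then (v i + w i) mod Wmod p m i else 0)"

text \<open>The automorphism phi: phi(a_i) = a_i a_(i+1) (0 <= i <= p-2),
  phi(a_(p-1)) = a_(p-1) * prod_(j=1..p-1) a_j^(-(p choose j)), in coordinates.\<close>
definition Wphi :: "nat \<Rightarrow> nat \<Rightarrow> (nat \<Rightarrow> int) \<Rightarrow> (nat \<Rightarrow> int)" where
  "Wphi p m w = (\<lambda>i. if i = 0 then w 0
      else if i < p then (w i + w (i - 1) - int (p choose i) * w (p - 1)) mod Wmod p m i
      else 0)"

text \<open>U = W \<rtimes> \<langle>b0\<rangle> with b0^(-1) w b0 = phi(w). The pair (k, w) stands for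
  b0^k * w (0 <= k < p^(m-1)); then
  (b0^k1 w1)(b0^k2 w2) = b0^(k1+k2) phi^k2(w1) w2.\<close>
definition U_mult :: "nat \<Rightarrow> nat \<Rightarrow> nat \<times> (nat \<Rightarrow> int) \<Rightarrow> nat \<times> (nat \<Rightarrow> int) \<Rightarrow> nat \<times> (nat \<Rightarrow> int)" where
  "U_mult p m x y = ((fst x + fst y) mod p ^ (m - 1), Wplus p m ((Wphi p m ^^ fst y) (snd x)) (snd y))"

definition U_grp :: "nat \<Rightarrow> nat \<Rightarrow> (nat \<times> (nat \<Rightarrow> int)) monoid" where
  "U_grp p m = \<lparr> partial_object.carrier = {..< p ^ (m - 1)} \<times> Wcarrier p m,
     monoid.mult = U_mult p m, monoid.one = (0, \<lambda>_. 0) \<rparr>"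

definition U_a0 :: "nat \<Rightarrow> nat \<Rightarrow> nat \<times> (nat \<Rightarrow> int)" where
  "U_a0 p m = (0, \<lambda>i. if i = 0 then 1 else 0)"

definition U_d :: "nat \<Rightarrow> nat \<Rightarrow> nat \<times> (nat \<Rightarrow> int)" where
  "U_d p m = (0, \<lambda>i. if i = 0 then int p ^ (m - 1) else if i = p - 1 then int p ^ (m - 2) else 0)"

definition U_D :: "nat \<Rightarrow> nat \<Rightarrow> (nat \<times> (nat \<Rightarrow> int)) set" where
  "U_D p m = generate (U_grp p m) {U_d p m}"

definition U_NN :: "nat \<Rightarrow> nat \<Rightarrow> (nat \<times> (nat \<Rightarrow> int)) set set" where
  "U_NN p m = {N. N \<lhd> U_grp p m \<and> U_D p m \<subseteq> N \<and> N \<subseteq> frattini (U_grp p m)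
      \<and> N \<inter> generate (U_grp p m) {U_a0 p m} = {\<one>\<^bsub>U_grp p m\<^esub>}
      \<and> \<not> derived (U_grp p m) (carrier (U_grp p m)) \<subseteq> N}"

end

theory Submission
  imports Defs
begin

text \<open>In a finite \<open>p\<close>-group every maximal subgroup is normal and contains all commutators and
  all \<open>p\<close>-th powers. If \<open>P\<close> is exponent-critical of exponent \<open>p^m\<close> and type A, with abelian maximal
  subgroup \<open>A\<close>, then every element \<open>a\<close> of order \<open>p^m\<close> lies in \<open>A\<close> and, for every \<open>b\<close> outside \<open>A\<close>,
  generates \<open>P\<close> together with \<open>b\<close>: otherwise \<open>a\<close> would lie in a proper non-abelian subgroup. A maximal
  subgroup through \<open>b\<close> is non-abelian, so commutators and elements outside \<open>A\<close> are killed by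
  \<open>p^(m-1)\<close>. With \<open>c_0 = a\<close> and \<open>c_(i+1) = [c_i, b]\<close>, expanding the trivial action of \<open>b^p\<close> on \<open>A\<close>
  expresses \<open>c_p\<close> through \<open>c_1, \<dots>, c_(p-1)\<close> exactly as in the definition of \<open>\<phi>\<close>, so
  \<open>a_i \<mapsto> c_i, b_0 \<mapsto> b\<close> extends to an epimorphism from \<open>U\<close>; its kernel contains \<open>D\<close> because
  \<open>(b a)^(p^(m-1)) = a^(p^(m-1)) c_(p-1)^(p^(m-2))\<close>.

  Conversely, in \<open>U/N\<close> this identity, with the norm \<open>w \<mapsto> b^(-p) (b w)^p\<close> on \<open>A\<close> being a
  homomorphism that kills commutators with \<open>b\<close>, shows that all elements outside \<open>A\<close> are killed by
  \<open>p^(m-1)\<close>; a proper subgroup with an element of order \<open>p^m\<close> is then contained in \<open>A\<close>.\<close>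

section \<open>Maximal subgroups of finite p-groups\<close>

text \<open>Orbit sizes are powers of \<open>p\<close>. If \<open>x\<close> were the only fixed
  point, every other orbit would have size divisible by \<open>p\<close>, so \<open>card E\<close>
  would be 1 modulo \<open>p\<close>.\<close>

lemma (in group_action) p_group_second_fixed_point:
  assumes p: "Factorial_Ring.prime (p::nat)" and ord: "order G = p ^ k"
    and fin: "finite E" and dv: "p dvd card E"
    and x: "x \<in> E" "\<And>g. g \<in> carrier G \<Longrightarrow> \<phi> g x = x"
  shows "\<exists>y\<in>E. y \<noteq> x \<and> (\<forall>g\<in>carrier G. \<phi> g y = y)"
proof (rule ccontr)
  assume neg: "\<not> ?thesis"
  interpret H: group_hom G "BijGroup E" \<phi> by (rule group_hom)
  have orb_x: "orbit G \<phi> x = {x}"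
    unfolding orbit_def using x(2) H.one_closed by force
  interpret P: partition E "orbits G E \<phi>" by (rule orbit_partition)
  have dvd_orb: "p dvd card (orbit G \<phi> y)" if y: "y \<in> E" "y \<noteq> x" for y
  proof -
    have "card (orbit G \<phi> y) dvd p ^ k"
      using orbit_stabilizer_theorem[OF y(1)] ord by (metis dvd_triv_left)
    then obtain i where i: "card (orbit G \<phi> y) = p ^ i"
      using p divides_primepow_nat by blast
    have "i \<noteq> 0"
    proof
      assume "i = 0"
      then have "card (orbit G \<phi> y) = 1" using i by simp
      then obtain z where z: "orbit G \<phi> y = {z}" by (auto simp: card_1_singleton_iff)
      have "\<phi> g y = y" if "g \<in> carrier G" for g
      proof -
        have "\<phi> g y \<in> orbit G \<phi> y" using that unfolding orbit_def by blast
        moreover have "y \<in> orbit G \<phi> y" using orbit_refl y(1) by blast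
        ultimately show ?thesis using z by auto
      qed
      then show False using neg y by blast
    qed
    then show ?thesis using i by simp
  qed
  define C where "C = orbits G E \<phi> - {{x}}"
  have un: "\<Union>C = E - {x}"
  proof -
    have "{x} \<in> orbits G E \<phi>" unfolding orbits_def using x(1) orb_x by blast
    then have "partition (E - {x}) C"
      unfolding C_def using P.remove_elem by blast
    then show ?thesis using partition.partition_coverture by blast
  qed
  have "p dvd card (\<Union>C)"
  proof (rule dvd_partition)
    show "finite (\<Union>C)" using un fin by simp
    show "\<forall>c\<in>C. p dvd card c"
    proof
      fix c assume c: "c \<in> C"
      then obtain y where y: "y \<in> E" "c = orbit G \<phi> y" unfolding C_def orbits_def by blast
      then have "y \<noteq> x" using c orb_x unfolding C_def by auto
      then show "p dvd card c" using dvd_orb y by simp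
    qed
    show "\<forall>c1\<in>C. \<forall>c2\<in>C. c1 \<noteq> c2 \<longrightarrow> c1 \<inter> c2 = {}"
      unfolding C_def using P.disjoint_union by blast
  qed
  then have "p dvd card E - 1" using un x(1) fin by simp
  moreover have "card E > 0" using x(1) fin card_gt_0_iff by blast
  ultimately have "p dvd 1" using dv by (metis Suc_pred' dvd_diffD1 One_nat_def Suc_leI)
  then show False using p by (simp add: prime_nat_iff)
qed

lemma (in group) inv_mult_cancel:
  assumes "x \<in> carrier G" "y \<in> carrier G"
  shows "x \<otimes> (inv x \<otimes> y) = y" "inv x \<otimes> (x \<otimes> y) = y"
  using assms by (simp_all flip: m_assoc)

text \<open>Bezout: with u k + v l = 1, \<open>x\<close> is a product of powers of the two given
  elements of \<open>H\<close>.\<close>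

lemma (in group) mem_subgroup_if_coprime_pows:
  assumes H: "subgroup H G" and x: "x \<in> carrier G"
    and k: "x [^] (k::int) \<in> H" and l: "x [^] (l::int) \<in> H" and "coprime k l"
  shows "x \<in> H"
proof -
  obtain u v where uv: "u * k + v * l = 1"
    using bezout_int[of k l] assms(5) by auto
  have "x = x [^] (u * k + v * l)" using uv x by simp
  also have "\<dots> = (x [^] k) [^] u \<otimes> (x [^] l) [^] v"
    using x by (simp add: int_pow_mult int_pow_pow mult.commute)
  also have "\<dots> \<in> H"
    using subgroup_int_pow_closed[OF H k] subgroup_int_pow_closed[OF H l] by (rule subgroup.m_closed[OF H])
  finally show ?thesis .
qed

text \<open>Mostly used in contrapositive form: if \<open>x [^] p\<close> but not \<open>x\<close>
  lies in \<open>H\<close>, then only exponents divisible by \<open>p\<close> bring \<open>x\<close>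
  into \<open>H\<close>.\<close>

lemma (in group) mem_subgroup_if_prime_pow:
  assumes H: "subgroup H G" and x: "x \<in> carrier G" and p: "Factorial_Ring.prime (p::nat)"
    and xp: "x [^] p \<in> H" and k: "x [^] (k::int) \<in> H" and ndvd: "\<not> int p dvd k"
  shows "x \<in> H"
proof (rule mem_subgroup_if_coprime_pows[OF H x])
  show "x [^] int p \<in> H" using xp by (simp add: int_pow_int)
  show "coprime (int p) k" using p ndvd by (intro prime_imp_coprime) auto
qed (rule k)

text \<open>The inverse turns right multiplication into a left action; the restriction to the set of
  cosets is what membership in \<open>BijGroup\<close> requires.\<close>

lemma (in group) coset_action:
  assumes M: "subgroup M G"
  shows "group_action (G\<lparr>carrier := M\<rparr>) (rcosets M) (\<lambda>g. \<lambda>C\<in>rcosets M. C #> inv g)"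
proof -
  interpret M: subgroup M G by (rule M)
  have cl: "C #> g \<in> rcosets M" if "C \<in> rcosets M" "g \<in> carrier G" for C g
    using that M.subset unfolding RCOSETS_def by (auto simp: coset_mult_assoc intro!: rcosetsI)
  have sub: "C \<subseteq> carrier G" if "C \<in> rcosets M" for C
    using that M.rcosets_carrier is_group by blast
  have act: "(C #> g) #> h = C #> (g \<otimes> h)" if "C \<in> rcosets M" "g \<in> carrier G" "h \<in> carrier G" for C g h
    using coset_mult_assoc sub that by blast
  have bij: "bij_betw (\<lambda>C\<in>rcosets M. C #> inv g) (rcosets M) (rcosets M)" if g: "g \<in> carrier G" for g
  proof (rule bij_betw_byWitness[where f' = "\<lambda>C. C #> g"])
    show "\<forall>a\<in>rcosets M. (\<lambda>C\<in>rcosets M. C #> inv g) a #> g = a"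
      using g by (simp add: act sub)
    show "\<forall>a'\<in>rcosets M. (\<lambda>C\<in>rcosets M. C #> inv g) (a' #> g) = a'"
      using g by (simp add: act sub cl)
  qed (use g cl in auto)
  have gr: "group (G\<lparr>carrier := M\<rparr>)" using M.subgroup_is_group is_group by blast
  show ?thesis
  proof (unfold group_action_def group_hom_def group_hom_axioms_def, intro conjI)
    show "group (G\<lparr>carrier := M\<rparr>)" by (rule gr)
    show "group (BijGroup (rcosets M))" by (rule group_BijGroup)
    show "(\<lambda>g. \<lambda>C\<in>rcosets M. C #> inv g) \<in> hom (G\<lparr>carrier := M\<rparr>) (BijGroup (rcosets M))"
    proof (rule homI)
      fix g assume "g \<in> carrier (G\<lparr>carrier := M\<rparr>)"
      then show "(\<lambda>C\<in>rcosets M. C #> inv g) \<in> carrier (BijGroup (rcosets M))"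
        using bij by (simp add: BijGroup_def Bij_def)
    next
      fix g h assume "g \<in> carrier (G\<lparr>carrier := M\<rparr>)" "h \<in> carrier (G\<lparr>carrier := M\<rparr>)"
      then have gh: "g \<in> carrier G" "h \<in> carrier G" by auto
      show "(\<lambda>C\<in>rcosets M. C #> inv (g \<otimes>\<^bsub>G\<lparr>carrier := M\<rparr>\<^esub> h)) =
          (\<lambda>C\<in>rcosets M. C #> inv g) \<otimes>\<^bsub>BijGroup (rcosets M)\<^esub> (\<lambda>C\<in>rcosets M. C #> inv h)"
      proof -
        have "(\<lambda>C\<in>rcosets M. C #> inv g) \<in> Bij (rcosets M)" "(\<lambda>C\<in>rcosets M. C #> inv h) \<in> Bij (rcosets M)"
          using bij gh by (simp_all add: Bij_def)
        moreover have "(\<lambda>C\<in>rcosets M. C #> inv (g \<otimes> h)) =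
            compose (rcosets M) (\<lambda>C\<in>rcosets M. C #> inv g) (\<lambda>C\<in>rcosets M. C #> inv h)"
          using gh by (auto simp: compose_def fun_eq_iff act cl inv_mult_group)
        ultimately show ?thesis by (simp add: BijGroup_def)
      qed
    qed
  qed
qed

text \<open>In a finite group the inverse of \<open>x\<close> is its power with exponent
  \<open>order G - 1\<close>.\<close>

lemma (in group) subgroup_if_mult_closed:
  assumes "finite (carrier G)" "K \<subseteq> carrier G" "\<one> \<in> K"
    and cl: "\<And>x y. x \<in> K \<Longrightarrow> y \<in> K \<Longrightarrow> x \<otimes> y \<in> K"
  shows "subgroup K G"
proof
  fix x assume x: "x \<in> K"
  have pw: "x [^] (n::nat) \<in> K" for n
    by (induction n) (use assms x in auto)
  have xc: "x \<in> carrier G" using x assms by blast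
  have "order G > 0" using assms(1) order_gt_0_iff_finite by blast
  then have "x [^] (order G - 1) \<otimes> x = \<one>"
    using pow_order_eq_1[OF xc] nat_pow_Suc[of x "order G - 1"] by simp
  then show "inv x \<in> K" using pw[of "order G - 1"] xc inv_equality[of "x [^] (order G - 1)" x] by simp
qed (use assms in auto)

lemma (in group) maximal_subgroup_containing:
  assumes fin: "finite (carrier G)" and H: "subgroup H G" "H \<noteq> carrier G"
  shows "\<exists>M. maximal_subgroup M G \<and> H \<subseteq> M"
proof -
  let ?S = "{K. subgroup K G \<and> K \<noteq> carrier G \<and> H \<subseteq> K}"
  have "finite ?S"
    by (rule finite_subset[of _ "Pow (carrier G)"]) (use fin subgroup.subset in auto)
  moreover have "H \<in> ?S" using H by auto
  ultimately have "\<exists>M\<in>?S. \<forall>K\<in>?S. M \<subseteq> K \<longrightarrow> M = K"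
    by (intro finite_has_maximal) auto
  then obtain M where M: "M \<in> ?S" "\<forall>K\<in>?S. M \<subseteq> K \<longrightarrow> M = K" by (rule bexE)
  have "maximal_subgroup M G"
    unfolding maximal_subgroup_def
  proof (intro conjI allI impI)
    fix K assume K: "subgroup K G \<and> M \<subseteq> K"
    show "K = M \<or> K = carrier G"
    proof (rule disjCI)
      assume "K \<noteq> carrier G"
      then have "K \<in> ?S" using M(1) K by auto
      then show "K = M" using M(2) K by auto
    qed
  qed (use M in auto)
  then show ?thesis using M(1) by blast
qed

text \<open>\<open>M\<close> acts on its cosets by right multiplication and fixes \<open>M\<close>; a second fixed coset \<open>M x\<close>
  yields an element \<open>x\<close> outside \<open>M\<close> normalising \<open>M\<close>.\<close>

lemma (in group) maximal_subgroup_normal: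
  assumes p: "Factorial_Ring.prime p" and pG: "p_group p G" and mx: "maximal_subgroup M G"
  shows "M \<lhd> G"
proof -
  have fin: "finite (carrier G)" using pG unfolding p_group_def by blast
  obtain k where k: "order G = p ^ k" using pG unfolding p_group_def order_def by blast
  have M: "subgroup M G" "M \<noteq> carrier G"
    and Mmax: "\<And>K. subgroup K G \<Longrightarrow> M \<subseteq> K \<Longrightarrow> K = M \<or> K = carrier G"
    using mx unfolding maximal_subgroup_def by auto
  interpret M: subgroup M G by (rule M)
  have finM: "finite M" using fin M.subset finite_subset by blast
  let ?E = "rcosets M"
  have lag: "card ?E * card M = p ^ k" using lagrange[OF M(1)] k by simp
  then obtain j where j: "card M = p ^ j" using divides_primepow_nat[OF p] by (metis dvd_triv_right)
  obtain i where i: "card ?E = p ^ i" using divides_primepow_nat[OF p] lag by (metis dvd_triv_left)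
  have "i \<noteq> 0"
  proof
    assume "i = 0"
    then have "card M = card (carrier G)" using i lag k unfolding order_def by simp
    then show False using M(2) card_subset_eq[OF fin M.subset] by blast
  qed
  then have dv: "p dvd card ?E" using i by simp
  interpret A: group_action "G\<lparr>carrier := M\<rparr>" ?E "\<lambda>g. \<lambda>C\<in>rcosets M. C #> inv g"
    by (rule coset_action[OF M(1)])
  have ME: "M \<in> ?E" using M.subgroup_in_rcosets is_group by blast
  have fixM: "(\<lambda>C\<in>rcosets M. C #> inv g) M = M" if "g \<in> carrier (G\<lparr>carrier := M\<rparr>)" for g
    using that ME by (simp add: M.rcos_const is_group)
  have finE: "finite ?E" using fin by (simp add: RCOSETS_def)
  obtain C where C: "C \<in> ?E" "C \<noteq> M" "\<forall>g\<in>M. (\<lambda>C\<in>rcosets M. C #> inv g) C = C"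
    using A.p_group_second_fixed_point[OF p _ finE dv ME fixM, of j] j by (auto simp: order_def)
  obtain x where x: "x \<in> carrier G" "C = M #> x" using C(1) unfolding RCOSETS_def by blast
  have xM: "x \<notin> M" using C(2) x M.rcos_const is_group by blast
  \<comment> \<open>\<open>K\<close> is the normaliser of \<open>M\<close>, given by a one-sided
    inclusion, which suffices because \<open>G\<close> is finite. It contains \<open>M\<close> and
    the outside element \<open>x\<close>, so maximality makes it all of \<open>G\<close>.\<close>
  define K where "K = {g \<in> carrier G. \<forall>h\<in>M. g \<otimes> h \<otimes> inv g \<in> M}"
  have "x \<in> K"
    unfolding K_def
  proof (safe intro!: x)
    fix h assume h: "h \<in> M"
    have hc: "h \<in> carrier G" using h by auto
    \<comment> \<open>The action multiplies by inverses, so it is applied to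
      \<open>inv h\<close>.\<close>
    have "C #> inv (inv h) = C" using C(1,3) h by (metis M.m_inv_closed restrict_apply')
    then have "(M #> x) #> h = M #> x" using x hc by simp
    then have "M #> (x \<otimes> h) = M #> x" using x hc coset_mult_assoc M.subset by simp
    then have "x \<otimes> h \<in> M #> x" using x hc M(1) by (metis m_closed rcos_self)
    then show "x \<otimes> h \<otimes> inv x \<in> M" using x hc M.rcos_module_imp is_group by blast
  qed
  have "subgroup K G"
  proof (rule subgroup_if_mult_closed[OF fin])
    show "K \<subseteq> carrier G" "\<one> \<in> K" unfolding K_def by auto
    fix g g' assume g: "g \<in> K" "g' \<in> K"
    have gc: "g \<in> carrier G" "g' \<in> carrier G" using g unfolding K_def by auto
    show "g \<otimes> g' \<in> K" unfolding K_def
    proof (safe intro!: m_closed gc)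
      fix h assume h: "h \<in> M"
      have "g \<otimes> (g' \<otimes> h \<otimes> inv g') \<otimes> inv g \<in> M" using g h unfolding K_def by blast
      moreover have "g \<otimes> g' \<otimes> h \<otimes> inv (g \<otimes> g') = g \<otimes> (g' \<otimes> h \<otimes> inv g') \<otimes> inv g"
        using gc h M.subset by (simp add: m_assoc inv_mult_group subset_iff)
      ultimately show "g \<otimes> g' \<otimes> h \<otimes> inv (g \<otimes> g') \<in> M" by simp
    qed
  qed
  moreover have "M \<subseteq> K" unfolding K_def using M.subset by auto
  ultimately have "K = carrier G" using Mmax \<open>x \<in> K\<close> xM by blast
  then show ?thesis
    unfolding normal_inv_iff using M(1) K_def by blast
qed

text \<open>This set is the product of the normal subgroup \<open>H\<close> and the cyclic group
  generated by \<open>g\<close>; moving a power of \<open>g\<close> past an element of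
  \<open>H\<close> only conjugates that element.\<close>

lemma (in normal) subgroup_mult_powers:
  assumes g: "g \<in> carrier G"
  shows "subgroup {h \<otimes> g [^] k | h (k::int). h \<in> H} G" (is "subgroup ?K G")
proof
  show "?K \<subseteq> carrier G" using g subset by auto
  show "\<one> \<in> ?K" using g one_closed by (auto intro!: exI[of _ \<one>] exI[of _ "0::int"])
next
  fix x y assume "x \<in> ?K" "y \<in> ?K"
  then obtain h h' and k k' :: int
    where xy: "h \<in> H" "h' \<in> H" "x = h \<otimes> g [^] k" "y = h' \<otimes> g [^] k'" by blast
  have "x \<otimes> y = (h \<otimes> (g [^] k \<otimes> h' \<otimes> inv (g [^] k))) \<otimes> g [^] (k + k')"
    using xy g by (simp add: m_assoc int_pow_mult inv_mult_cancel)
  moreover have "h \<otimes> (g [^] k \<otimes> h' \<otimes> inv (g [^] k)) \<in> H"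
    using xy g inv_op_closed2[of "g [^] k" h'] by simp
  ultimately show "x \<otimes> y \<in> ?K" by blast
next
  fix x assume "x \<in> ?K"
  then obtain h and k :: int where x: "h \<in> H" "x = h \<otimes> g [^] k" by blast
  have "inv x = (inv (g [^] k) \<otimes> inv h \<otimes> g [^] k) \<otimes> g [^] (- k)"
    using x g by (simp add: m_assoc inv_mult_group int_pow_neg)
  moreover have "inv (g [^] k) \<otimes> inv h \<otimes> g [^] k \<in> H"
    using x g inv_op_closed1[of "g [^] k" "inv h"] by simp
  ultimately show "inv x \<in> ?K" by blast
qed

text \<open>The product of \<open>M\<close> and the powers of \<open>g\<close> is a subgroup
  strictly above \<open>M\<close>, hence everything: \<open>G/M\<close> is cyclic, generated by the
  image of any element outside \<open>M\<close>.\<close>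

lemma (in group) maximal_subgroup_mult_powers:
  assumes nM: "M \<lhd> G" and mx: "maximal_subgroup M G" and g: "g \<in> carrier G" "g \<notin> M"
    and y: "y \<in> carrier G"
  shows "\<exists>h\<in>M. \<exists>k::int. y = h \<otimes> g [^] k"
proof -
  interpret M: normal M G by (rule nM)
  let ?K = "{h \<otimes> g [^] k | h (k::int). h \<in> M}"
  have "M \<subseteq> ?K"
  proof
    fix h assume "h \<in> M"
    then have "h = h \<otimes> g [^] (0::int)" by simp
    then show "h \<in> ?K" using \<open>h \<in> M\<close> by blast
  qed
  moreover have "g \<in> ?K"
  proof -
    have "g = \<one> \<otimes> g [^] (1::int)" using g by simp
    then show ?thesis using M.one_closed by blast
  qed
  ultimately have "?K = carrier G"
    using M.subgroup_mult_powers[OF g(1)] mx g unfolding maximal_subgroup_def by blast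
  then show ?thesis using y by blast
qed

text \<open>For \<open>x\<close> outside \<open>M\<close>, write y = h x^k with h in
  \<open>M\<close>. Since x^k commutes with x, the commutator collapses to that of x and h, which
  lies in \<open>M\<close> by normality.\<close>

lemma (in group) maximal_subgroup_commutator:
  assumes p: "Factorial_Ring.prime p" and pG: "p_group p G" and mx: "maximal_subgroup M G"
    and xy: "x \<in> carrier G" "y \<in> carrier G"
  shows "x \<otimes> y \<otimes> inv x \<otimes> inv y \<in> M"
proof -
  have nM: "M \<lhd> G" by (rule maximal_subgroup_normal[OF p pG mx])
  interpret M: normal M G by (rule nM)
  show ?thesis
  proof (cases "x \<in> M")
    case True
    have "x \<otimes> (y \<otimes> inv x \<otimes> inv y) \<in> M"
      using True xy M.inv_op_closed2[of y "inv x"] by simp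
    then show ?thesis using xy by (simp add: m_assoc)
  next
    case False
    obtain h and k :: int where h: "h \<in> M" "y = h \<otimes> x [^] k"
      using maximal_subgroup_mult_powers[OF nM mx xy(1) False xy(2)] by blast
    have hc: "h \<in> carrier G" using h by auto
    have c: "x [^] k \<otimes> inv x = inv x \<otimes> x [^] k"
      using xy int_pow_mult[of x k "-1"] int_pow_mult[of x "-1" k] by (simp add: int_pow_neg)
    have "x \<otimes> y \<otimes> inv x \<otimes> inv y = x \<otimes> h \<otimes> (x [^] k \<otimes> inv x) \<otimes> inv (x [^] k) \<otimes> inv h"
      using h hc xy by (simp add: m_assoc inv_mult_group inv_mult_cancel)
    also have "\<dots> = x \<otimes> h \<otimes> inv x \<otimes> inv h"
      unfolding c using hc xy by (simp add: m_assoc inv_mult_cancel)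
    also have "\<dots> \<in> M" using h xy M.inv_op_closed2[of x h] by simp
    finally show ?thesis .
  qed
qed

text \<open>Otherwise \<open>x\<close> would be an element of \<open>M\<close> times a power of x^p,
  so some x^(1 - p k) would lie in \<open>M\<close>. As 1 - p k is coprime to the order of
  \<open>G\<close>, \<open>x\<close> itself would lie in \<open>M\<close>.\<close>

lemma (in group) maximal_subgroup_pow:
  assumes p: "Factorial_Ring.prime p" and pG: "p_group p G" and mx: "maximal_subgroup M G"
    and x: "x \<in> carrier G"
  shows "x [^] p \<in> M"
proof (rule ccontr)
  assume n: "x [^] p \<notin> M"
  have nM: "M \<lhd> G" by (rule maximal_subgroup_normal[OF p pG mx])
  interpret M: normal M G by (rule nM)
  obtain h and k :: int where h: "h \<in> M" "x = h \<otimes> (x [^] p) [^] k"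
    using maximal_subgroup_mult_powers[OF nM mx _ n x] x by blast
  have "x = h \<otimes> x [^] (int p * k)" using h(2) x int_pow_pow int_pow_int by metis
  then have "h = x [^] (1 - int p * k)"
    using h(1) x by (metis M.mem_carrier int_pow_1 int_pow_closed int_pow_diff inv_solve_right)
  then have hM: "x [^] (1 - int p * k) \<in> M" using h(1) by simp
  obtain r where r: "order G = p ^ r" using pG unfolding p_group_def order_def by blast
  have "x [^] (int p ^ r) = \<one>"
    using pow_order_eq_1[OF x] r int_pow_int[of G x "p ^ r"] by simp
  then have "x [^] (int p ^ r) \<in> M" by simp
  moreover have "coprime (1 - int p * k) (int p ^ r)"
  proof -
    have "coprime (1 - int p * k) (int p)"
    proof (rule coprimeI)
      fix c assume "c dvd 1 - int p * k" "c dvd int p"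
      then have "c dvd (1 - int p * k) + int p * k" by (intro dvd_add dvd_mult2)
      then show "is_unit c" by simp
    qed
    then show ?thesis by simp
  qed
  ultimately have "x \<in> M"
    using mem_subgroup_if_coprime_pows[OF normal_imp_subgroup[OF nM] x hM] by blast
  then have "x [^] p \<in> M"
    using subgroup_int_pow_closed[OF normal_imp_subgroup[OF nM], of x "int p"] int_pow_int by metis
  then show False using n by simp
qed

section \<open>Products of powers in an abelian subgroup\<close>

text \<open>The evaluation map from integral exponent vectors to group elements. The order of the
  factors is fixed so that it makes sense in a non-abelian \<open>G\<close>; it is additive in
  \<open>v\<close> once the \<open>g i\<close> lie in an abelian subgroup.\<close>

primrec pow_prod :: "('a, 'c) monoid_scheme \<Rightarrow> (nat \<Rightarrow> 'a) \<Rightarrow> nat \<Rightarrow> (nat \<Rightarrow> int) \<Rightarrow> 'a" where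
  "pow_prod G g 0 v = \<one>\<^bsub>G\<^esub>"
| "pow_prod G g (Suc n) v = pow_prod G g n v \<otimes>\<^bsub>G\<^esub> g n [^]\<^bsub>G\<^esub> v n"

text \<open>Powers rather than exponents are compared, so that exponents may be changed modulo the
  orders of the \<open>g i\<close>.\<close>

lemma pow_prod_cong:
  assumes "\<And>i. i < n \<Longrightarrow> g i [^]\<^bsub>G\<^esub> v i = g' i [^]\<^bsub>G\<^esub> v' i"
  shows "pow_prod G g n v = pow_prod G g' n v'"
  using assms by (induction n) auto

lemma (in group_hom) hom_pow_prod:
  assumes "\<And>i. i < n \<Longrightarrow> g i \<in> carrier G"
  shows "pow_prod G g n v \<in> carrier G \<and> h (pow_prod G g n v) = pow_prod H (\<lambda>i. h (g i)) n v"
  using assms by (induction n) (auto simp: hom_int_pow)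

locale abelian_subgroup = group G for G (structure) +
  fixes A
  assumes A_subgroup: "subgroup A G"
    and A_comm: "\<And>x y. x \<in> A \<Longrightarrow> y \<in> A \<Longrightarrow> x \<otimes> y = y \<otimes> x"
begin

lemma A_carrier [simp, intro]: "x \<in> A \<Longrightarrow> x \<in> carrier G"
  by (rule subgroup.mem_carrier[OF A_subgroup])

lemma A_mult [simp, intro]: "x \<in> A \<Longrightarrow> y \<in> A \<Longrightarrow> x \<otimes> y \<in> A"
  by (rule subgroup.m_closed[OF A_subgroup])

lemma A_one [simp, intro]: "\<one> \<in> A"
  by (rule subgroup.one_closed[OF A_subgroup])

lemma A_inv [simp, intro]: "x \<in> A \<Longrightarrow> inv x \<in> A"
  by (rule subgroup.m_inv_closed[OF A_subgroup])

lemma A_int_pow [simp, intro]: "x \<in> A \<Longrightarrow> x [^] (k::int) \<in> A"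
  using subgroup_int_pow_closed[OF A_subgroup] .

lemma A_nat_pow [simp, intro]: "x \<in> A \<Longrightarrow> x [^] (k::nat) \<in> A"
  by (induction k) auto

lemma A_lcomm: "x \<in> A \<Longrightarrow> y \<in> A \<Longrightarrow> z \<in> A \<Longrightarrow> x \<otimes> (y \<otimes> z) = y \<otimes> (x \<otimes> z)"
  using A_comm by (metis A_carrier m_assoc)

lemma A_pow_distrib: "x \<in> A \<Longrightarrow> y \<in> A \<Longrightarrow> (x \<otimes> y) [^] (k::int) = x [^] k \<otimes> y [^] k"
  by (intro int_pow_mult_distrib A_comm) auto

lemma A_nat_pow_distrib: "x \<in> A \<Longrightarrow> y \<in> A \<Longrightarrow> (x \<otimes> y) [^] (k::nat) = x [^] k \<otimes> y [^] k"
  by (intro pow_mult_distrib A_comm) auto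

lemma A_pow_zero: "x \<in> A \<Longrightarrow> x [^] (n::nat) = \<one> \<Longrightarrow> (x [^] (k::int)) [^] n = \<one>"
  by (metis A_carrier int_pow_int int_pow_one int_pow_pow mult.commute)

lemma pow_prod_closed [simp, intro]:
  "(\<And>i. i < n \<Longrightarrow> g i \<in> A) \<Longrightarrow> pow_prod G g n v \<in> A"
  by (induction n) auto

lemma pow_prod_add:
  assumes "\<And>i. i < n \<Longrightarrow> g i \<in> A"
  shows "pow_prod G g n (\<lambda>i. v i + w i) = pow_prod G g n v \<otimes> pow_prod G g n w"
  using assms
proof (induction n)
  case (Suc n)
  have "g n \<in> A" "pow_prod G g n v \<in> A" "pow_prod G g n w \<in> A" using Suc.prems by auto
  then show ?case using Suc by (simp add: int_pow_mult m_assoc A_lcomm)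
qed simp

lemma pow_prod_scale:
  assumes "\<And>i. i < n \<Longrightarrow> g i \<in> A"
  shows "pow_prod G g n (\<lambda>i. k * v i) = pow_prod G g n v [^] k"
  using assms
proof (induction n)
  case (Suc n)
  have "g n \<in> A" "pow_prod G g n v \<in> A" using Suc.prems by auto
  then show ?case using Suc by (simp add: A_pow_distrib int_pow_pow mult.commute)
qed simp

lemma pow_prod_zero [simp]: "pow_prod G g n (\<lambda>i. 0) = \<one>"
  by (induction n) auto

text \<open>The recursion splits off the last factor. The first one must be isolated too, because
  \<open>g 0\<close> will be \<open>a\<close>, whose order has a different bound from the orders of
  the later terms.\<close>

lemma pow_prod_head:
  assumes "\<And>i. i \<le> n \<Longrightarrow> g i \<in> A"
  shows "pow_prod G g (Suc n) v = g 0 [^] v 0 \<otimes> pow_prod G (\<lambda>i. g (Suc i)) n (\<lambda>i. v (Suc i))"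
  using assms
proof (induction n)
  case (Suc n)
  have "g 0 \<in> A" "g (Suc n) \<in> A" "pow_prod G (\<lambda>i. g (Suc i)) n (\<lambda>i. v (Suc i)) \<in> A"
    using Suc.prems by auto
  moreover have "pow_prod G g (Suc n) v = g 0 [^] v 0 \<otimes> pow_prod G (\<lambda>i. g (Suc i)) n (\<lambda>i. v (Suc i))"
    using Suc by auto
  ultimately show ?case by (simp add: m_assoc)
qed simp

lemma pow_prod_vanish:
  assumes "\<And>i. i < n \<Longrightarrow> g i \<in> A" "\<And>i. i < n \<Longrightarrow> g i [^] (N::nat) = \<one>"
  shows "pow_prod G g n v [^] N = \<one>"
  using assms
proof (induction n)
  case (Suc n)
  have "g n \<in> A" "pow_prod G g n v \<in> A" using Suc.prems by auto
  then show ?case using Suc by (simp add: A_nat_pow_distrib A_pow_zero)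
qed simp

lemma pow_prod_in:
  assumes "subgroup M G" "\<And>i. i < n \<Longrightarrow> g i \<in> M"
  shows "pow_prod G g n v \<in> M"
  using assms(2)
  by (induction n)
    (use assms(1) subgroup_int_pow_closed[OF assms(1)] in \<open>auto simp: subgroup.one_closed subgroup.m_closed\<close>)

end

section \<open>The iterated commutator sequence\<close>

text \<open>The commutator is taken in the form for which conjugation by \<open>b\<close> sends c_i
  to c_i c_(i+1) when these terms commute, the same rule as for phi on the a_i.\<close>

primrec comm_seq :: "('a, 'c) monoid_scheme \<Rightarrow> 'a \<Rightarrow> 'a \<Rightarrow> nat \<Rightarrow> 'a" where
  "comm_seq G b a 0 = a"
| "comm_seq G b a (Suc i) =
    (inv\<^bsub>G\<^esub> b \<otimes>\<^bsub>G\<^esub> comm_seq G b a i \<otimes>\<^bsub>G\<^esub> b) \<otimes>\<^bsub>G\<^esub> inv\<^bsub>G\<^esub> (comm_seq G b a i)"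

lemma (in group_hom) hom_comm_seq:
  assumes "a \<in> carrier G" "b \<in> carrier G"
  shows "comm_seq G b a n \<in> carrier G \<and> h (comm_seq G b a n) = comm_seq H (h b) (h a) n"
  using assms by (induction n) auto

text \<open>The integral lift of the automorphism: the matrix of multiplication by \<open>1 + X\<close> on
  \<open>\<int>[X] / ((1 + X)^p - 1)\<close> with respect to the basis \<open>1, X, \<dots>, X^(p-1)\<close>.\<close>

definition phi_lift :: "nat \<Rightarrow> (nat \<Rightarrow> int) \<Rightarrow> nat \<Rightarrow> int" where
  "phi_lift p v = (\<lambda>i. if i = 0 then v 0
     else if i < p then v i + v (i - 1) - int (p choose i) * v (p - 1) else 0)"

text \<open>Exponent vector of the generator of \<open>U_D\<close>, kept integral so that
  \<open>pow_prod\<close> can evaluate it in any group.\<close>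

definition d_vec :: "nat \<Rightarrow> nat \<Rightarrow> nat \<Rightarrow> int" where
  "d_vec p m = (\<lambda>i. if i = 0 then int p ^ (m - 1) else if i = p - 1 then int p ^ (m - 2) else 0)"

text \<open>The relations of \<open>U\<close>, stated so that \<open>U\<close> itself, its
  homomorphic images and the given group \<open>P\<close> are all instances and share one
  calculus.\<close>

locale cyclic_extension = abelian_subgroup +
  fixes a b :: 'a and p m :: nat
  assumes p: "Factorial_Ring.prime p" and m: "2 \<le> m"
    and a_A: "a \<in> A" and b_carrier [simp]: "b \<in> carrier G"
    and conj_A: "\<And>x. x \<in> A \<Longrightarrow> inv b \<otimes> x \<otimes> b \<in> A"
    and b_pow_p: "b [^] p \<in> A"
    and b_exp: "b [^] (p ^ (m - 1)) = \<one>"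
    and a_exp: "a [^] (p ^ m) = \<one>"
    and comm_exp: "\<And>x. x \<in> A \<Longrightarrow> (inv b \<otimes> x \<otimes> b \<otimes> inv x) [^] (p ^ (m - 1)) = \<one>"
begin

lemma p_gt_1: "p > 1"
  using p prime_gt_1_nat by blast

definition cj where "cj x = inv b \<otimes> x \<otimes> b"

abbreviation c_seq where "c_seq \<equiv> comm_seq G b a"

abbreviation psi where "psi \<equiv> pow_prod G c_seq"

lemma cj_A [simp, intro]: "x \<in> A \<Longrightarrow> cj x \<in> A"
  unfolding cj_def by (rule conj_A)

lemma cj_mult: "x \<in> carrier G \<Longrightarrow> y \<in> carrier G \<Longrightarrow> cj (x \<otimes> y) = cj x \<otimes> cj y"
  unfolding cj_def by (simp add: m_assoc inv_mult_cancel)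

lemma cj_one [simp]: "cj \<one> = \<one>"
  unfolding cj_def by simp

lemma mult_cj: "x \<in> carrier G \<Longrightarrow> x \<otimes> b = b \<otimes> cj x"
  unfolding cj_def by (simp add: m_assoc inv_mult_cancel)

lemma cj_hom: "group_hom G G cj"
  by (intro group_hom.intro group_hom_axioms.intro homI is_group)
    (auto simp: cj_mult, auto simp: cj_def)

lemma cj_pow: "x \<in> A \<Longrightarrow> cj (x [^] (k::int)) = cj x [^] k"
  by (rule group_hom.hom_int_pow[OF cj_hom]) auto

lemma c_seq_A [simp, intro]: "c_seq i \<in> A"
  using a_A conj_A by (induction i) auto

lemma cj_c_seq: "cj (c_seq i) = c_seq i \<otimes> c_seq (Suc i)"
proof -
  have "c_seq i \<in> A" "cj (c_seq i) \<in> A" by auto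
  then show ?thesis
    by (simp add: cj_def[symmetric] A_comm[of "c_seq i"] m_assoc)
qed

declare comm_seq.simps(2) [simp del]

lemma c_seq_Suc_exp: "c_seq (Suc i) [^] (p ^ (m - 1)) = \<one>"
  using comm_exp[of "c_seq i"] by (simp add: comm_seq.simps)

lemma psi_A [simp, intro]: "psi n v \<in> A"
  by auto

lemma psi_add: "psi n (\<lambda>i. v i + w i) = psi n v \<otimes> psi n w"
  by (rule pow_prod_add) auto

lemma psi_scale: "psi n (\<lambda>i. k * v i) = psi n v [^] k"
  by (rule pow_prod_scale) auto

text \<open>Each factor c_i picks up a factor c_(i+1), and the factors can be regrouped because they
  lie in \<open>A\<close>.\<close>

lemma cj_psi: "cj (psi n v) = psi n v \<otimes> pow_prod G (\<lambda>i. c_seq (Suc i)) n v"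
proof (induction n)
  case (Suc n)
  have "pow_prod G (\<lambda>i. c_seq (Suc i)) n v \<in> A" by auto
  then show ?case
    using Suc by (simp add: cj_mult cj_pow cj_c_seq A_pow_distrib m_assoc A_lcomm)
qed simp

text \<open>Reindexing shifts the exponents up by one place: on exponent polynomials, conjugation by
  \<open>b\<close> is multiplication by 1 + X.\<close>

lemma cj_psi_shift: "cj (psi n v) = psi n v \<otimes> psi (Suc n) (\<lambda>i. if i = 0 then 0 else v (i - 1))"
proof -
  have *: "pow_prod G (\<lambda>i. c_seq (Suc i)) n v \<in> A" by auto
  show ?thesis
    unfolding cj_psi by (subst pow_prod_head) (use * in auto)
qed

text \<open>This is (1 + X)^n applied to \<open>a\<close>; the induction step is Pascal's
  rule.\<close>

lemma cj_iter_a: "(cj ^^ n) a = psi (Suc n) (\<lambda>j. int (n choose j))"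
proof (induction n)
  case 0
  then show ?case using a_A by simp
next
  case (Suc n)
  \<comment> \<open>The additional factor has exponent 0; it brings the vector to the length of its
    shift.\<close>
  have eq: "psi (Suc n) (\<lambda>j. int (n choose j)) = psi (Suc (Suc n)) (\<lambda>j. int (n choose j))"
    by (subst (2) pow_prod.simps) (simp add: binomial_eq_0 del: pow_prod.simps)
  have "(cj ^^ Suc n) a = psi (Suc (Suc n)) (\<lambda>j. int (n choose j))
      \<otimes> psi (Suc (Suc n)) (\<lambda>i. if i = 0 then 0 else int (n choose (i - 1)))"
    using Suc cj_psi_shift[of "Suc n" "\<lambda>j. int (n choose j)"] eq by simp
  also have "\<dots> = psi (Suc (Suc n)) (\<lambda>i. int (n choose i) + (if i = 0 then 0 else int (n choose (i - 1))))"
    by (rule psi_add[symmetric])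
  also have "(\<lambda>i. int (n choose i) + (if i = 0 then 0 else int (n choose (i - 1)))) = (\<lambda>i. int (Suc n choose i))"
  proof
    fix i show "int (n choose i) + (if i = 0 then 0 else int (n choose (i - 1))) = int (Suc n choose i)"
      by (cases i) auto
  qed
  finally show ?case .
qed

lemma cj_iter: "x \<in> carrier G \<Longrightarrow> (cj ^^ n) x = inv (b [^] n) \<otimes> x \<otimes> b [^] n"
proof (induction n)
  case (Suc n)
  then show ?case
    by (simp add: cj_def inv_mult_group m_assoc)
qed simp

text \<open>\<open>b [^] p\<close> lies in the abelian subgroup \<open>A\<close>, so conjugation by
  it is trivial there.\<close>

lemma cj_iter_p: "x \<in> A \<Longrightarrow> (cj ^^ p) x = x"
  using b_pow_p by (simp add: cj_iter m_assoc A_comm[of x] inv_mult_cancel)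

lemma psi_head_zero:
  "psi p (\<lambda>j. int (p choose j)) = a \<otimes> psi p (\<lambda>j. if j = 0 then 0 else int (p choose j))"
proof -
  obtain q where q: "p = Suc q" using p_gt_1 by (cases p) auto
  have "psi (Suc q) v = c_seq 0 [^] v 0 \<otimes> pow_prod G (\<lambda>i. c_seq (Suc i)) q (\<lambda>i. v (Suc i))" for v
    by (rule pow_prod_head) auto
  note h = this
  have "pow_prod G (\<lambda>i. c_seq (Suc i)) q v \<in> A" for v by auto
  then show ?thesis unfolding q using a_A by (simp only: h) simp
qed

text \<open>Expanding a = \<open>(cj ^^ p) a\<close> by \<open>cj_iter_a\<close> gives a factor
  \<open>a\<close> for j = 0 and c_p for j = p. Cancelling \<open>a\<close> shows that c_p is the
  inverse of the product over 0 < j < p.\<close>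

lemma c_seq_p: "c_seq p = psi p (\<lambda>j. if j = 0 then 0 else - int (p choose j))"
proof -
  let ?x = "psi p (\<lambda>j. if j = 0 then 0 else int (p choose j))"
  let ?y = "psi p (\<lambda>j. if j = 0 then 0 else - int (p choose j))"
  have in_A: "?x \<in> A" "?y \<in> A" "c_seq p \<in> A" by auto
  have "a = (cj ^^ p) a" using cj_iter_p a_A by simp
  also have "\<dots> = a \<otimes> ?x \<otimes> c_seq p"
    by (simp add: cj_iter_a psi_head_zero)
  finally have "a \<otimes> (?x \<otimes> c_seq p) = a" using in_A a_A by (simp add: m_assoc)
  then have 1: "?x \<otimes> c_seq p = \<one>" using in_A a_A by simp
  have "?y \<otimes> ?x = psi p (\<lambda>j. (if j = 0 then 0 else - int (p choose j)) + (if j = 0 then 0 else int (p choose j)))"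
    by (rule psi_add[symmetric])
  also have "\<dots> = psi p (\<lambda>j. 0)" by (rule pow_prod_cong) auto
  finally have 2: "?y \<otimes> ?x = \<one>" by simp
  have "c_seq p \<otimes> ?x = \<one>" using 1 A_comm[OF in_A(1,3)] by simp
  then have "inv ?x = c_seq p" using in_A by (intro inv_equality) auto
  moreover have "inv ?x = ?y" using 2 in_A by (intro inv_equality) auto
  ultimately show ?thesis by simp
qed

text \<open>The shift puts the last exponent on c_p, which \<open>c_seq_p\<close> folds back into
  the lower terms.\<close>

lemma cj_psi_phi: "cj (psi p v) = psi p (phi_lift p v)"
proof -
  let ?s = "\<lambda>i. if i = 0 then 0 else v (i - 1)"
  let ?u = "\<lambda>j. if j = 0 then 0 else - int (p choose j)"
  have "cj (psi p v) = psi p v \<otimes> (psi p ?s \<otimes> c_seq p [^] v (p - 1))"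
    using p_gt_1 by (simp add: cj_psi_shift)
  also have "\<dots> = psi p v \<otimes> (psi p ?s \<otimes> psi p (\<lambda>i. v (p - 1) * ?u i))"
    by (simp only: c_seq_p psi_scale)
  also have "\<dots> = psi p (\<lambda>i. v i + (?s i + v (p - 1) * ?u i))"
    by (simp only: psi_add)
  also have "\<dots> = psi p (phi_lift p v)"
    by (rule pow_prod_cong) (auto simp: phi_lift_def algebra_simps)
  finally show ?thesis .
qed

text \<open>The order of \<open>a\<close> divides p^m and that of each later c_i divides p^(m-1),
  and these are the moduli of W. Thus \<open>psi p\<close> is well defined on W.\<close>

lemma psi_mod:
  assumes "\<And>i. i < p \<Longrightarrow> v i mod Wmod p m i = w i mod Wmod p m i"
  shows "psi p v = psi p w"
proof (rule pow_prod_cong)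
  fix i assume i: "i < p"
  have "int (ord (c_seq i)) dvd Wmod p m i"
  proof (cases i)
    case 0
    then show ?thesis using a_exp a_A pow_eq_id[of a "p ^ m"] by (simp add: Wmod_def flip: of_nat_power)
  next
    case (Suc j)
    then show ?thesis
      using c_seq_Suc_exp[of j] pow_eq_id[of "c_seq (Suc j)" "p ^ (m - 1)"] by (simp add: Wmod_def flip: of_nat_power)
  qed
  then have "int (ord (c_seq i)) dvd v i - w i"
    using assms[OF i] by (meson mod_eq_dvd_iff dvd_trans)
  then show "c_seq i [^] v i = c_seq i [^] w i"
    by (simp add: int_pow_eq dvd_diff_commute)
qed

section \<open>The norm of \<open>A\<close> under \<open>b\<close> and powers of elements of the
  coset b A\<close>

primrec twisted_norm :: "nat \<Rightarrow> 'a \<Rightarrow> 'a" where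
  "twisted_norm 0 w = \<one>"
| "twisted_norm (Suc n) w = cj (twisted_norm n w) \<otimes> w"

lemma twisted_norm_A [simp, intro]: "w \<in> A \<Longrightarrow> twisted_norm n w \<in> A"
  by (induction n) auto

text \<open>\<open>twisted_norm n w\<close> is the product of the conjugates of \<open>w\<close> by
  b^(n-1), ..., b, 1 in Horner form; they arise when each new \<open>b\<close> is moved left past
  the factors from \<open>A\<close> collected so far.\<close>

lemma mult_b_pow: "w \<in> A \<Longrightarrow> (b \<otimes> w) [^] n = b [^] n \<otimes> twisted_norm n w"
proof (induction n)
  case (Suc n)
  have "b [^] n \<otimes> twisted_norm n w \<otimes> (b \<otimes> w) = b [^] n \<otimes> (twisted_norm n w \<otimes> b) \<otimes> w"
    using Suc.prems by (simp add: m_assoc)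
  also have "\<dots> = b [^] n \<otimes> (b \<otimes> cj (twisted_norm n w)) \<otimes> w"
    using Suc.prems by (subst mult_cj) auto
  finally show ?case using Suc by (simp add: m_assoc)
qed simp

text \<open>The coefficients are those of ((1 + X)^n - 1) / X, the sum of (1 + X)^i over i < n;
  Pascal's rule gives the step.\<close>

lemma twisted_norm_a: "twisted_norm n a = psi n (\<lambda>j. int (n choose Suc j))"
proof (induction n)
  case (Suc n)
  let ?c = "\<lambda>j. int (n choose Suc j)"
  have eq: "psi n ?c = psi (Suc n) ?c" by (simp add: binomial_eq_0)
  \<comment> \<open>\<open>a\<close> is written as an exponent vector of the same length, so that
    the three factors combine by \<open>psi_add\<close>.\<close>
  have a: "a = psi (Suc n) (\<lambda>i. if i = 0 then 1 else 0)"
  proof -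
    have "psi (Suc n) (\<lambda>i. if i = 0 then 1 else 0) = c_seq 0 [^] (1::int) \<otimes> pow_prod G (\<lambda>i. c_seq (Suc i)) n (\<lambda>i. 0)"
      by (subst pow_prod_head) auto
    then show ?thesis using a_A by simp
  qed
  have "twisted_norm (Suc n) a = psi (Suc n) ?c \<otimes> psi (Suc n) (\<lambda>i. if i = 0 then 0 else ?c (i - 1)) \<otimes> psi (Suc n) (\<lambda>i. if i = 0 then 1 else 0)"
    unfolding twisted_norm.simps Suc cj_psi_shift by (simp only: eq flip: a)
  also have "\<dots> = psi (Suc n) (\<lambda>i. ?c i + (if i = 0 then 0 else ?c (i - 1)) + (if i = 0 then 1 else 0))"
    by (simp only: psi_add)
  also have "\<dots> = psi (Suc n) (\<lambda>j. int (Suc n choose Suc j))"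
    by (rule pow_prod_cong) (auto simp: add.commute)
  finally show ?case .
qed simp

lemma p_pow_m1: "p ^ (m - 1) = p * p ^ (m - 2)"
  using m by (metis Suc_1 Suc_diff_le diff_Suc_Suc power_Suc)

text \<open>Both b^p and the norm lie in \<open>A\<close>, so the remaining power p^(m-2)
  distributes over them, and it kills b^p.\<close>

lemma mult_b_exp:
  assumes w: "w \<in> A"
  shows "(b \<otimes> w) [^] (p ^ (m - 1)) = twisted_norm p w [^] (p ^ (m - 2))"
proof -
  have "(b \<otimes> w) [^] (p ^ (m - 1)) = ((b \<otimes> w) [^] p) [^] (p ^ (m - 2))"
    unfolding p_pow_m1 using w by (simp add: nat_pow_pow)
  also have "\<dots> = (b [^] p \<otimes> twisted_norm p w) [^] (p ^ (m - 2))"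
    using w by (simp add: mult_b_pow)
  also have "\<dots> = (b [^] p) [^] (p ^ (m - 2)) \<otimes> twisted_norm p w [^] (p ^ (m - 2))"
    using b_pow_p w by (intro A_nat_pow_distrib) auto
  also have "(b [^] p) [^] (p ^ (m - 2)) = \<one>"
    using b_exp by (simp add: nat_pow_pow flip: p_pow_m1)
  finally show ?thesis using w by simp
qed

text \<open>Multiplied by p^(m-2), the coefficient p choose (j + 1) becomes p^(m-1) for j = 0 and
  p^(m-2) for j = p - 1; in between it is a multiple of p^(m-1), which annihilates c_j. This is
  where the generator of \<open>U_D\<close> comes from.\<close>

lemma ba_pow: "(b \<otimes> a) [^] (p ^ (m - 1)) = psi p (d_vec p m)"
proof -
  note m1 = p_pow_m1
  have "(b \<otimes> a) [^] (p ^ (m - 1)) = twisted_norm p a [^] (p ^ (m - 2))"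
    using a_A by (rule mult_b_exp)
  also have "\<dots> = psi p (\<lambda>j. int (p ^ (m - 2)) * int (p choose Suc j))"
    using a_A by (simp add: twisted_norm_a psi_scale int_pow_int del: of_nat_power)
  also have "\<dots> = psi p (d_vec p m)"
  proof (rule psi_mod)
    fix i assume i: "i < p"
    consider "i = 0" | "i \<noteq> 0" "i = p - 1" | "i \<noteq> 0" "Suc i < p" using i by linarith
    then show "(int (p ^ (m - 2)) * int (p choose Suc i)) mod Wmod p m i = d_vec p m i mod Wmod p m i"
    proof cases
      case 1
      have "int (p ^ (m - 2)) * int (p choose Suc i) = int (p ^ (m - 1))"
        using 1 m1 by (simp add: mult.commute)
      then show ?thesis using 1 by (simp add: d_vec_def)
    next
      case 2
      then have "Suc i = p" using i by simp
      then show ?thesis using 2 by (simp add: d_vec_def)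
    next
      case 3
      then have "p dvd (p choose Suc i)" using p by (intro dvd_choose_prime) auto
      then have "p ^ (m - 1) dvd p ^ (m - 2) * (p choose Suc i)" unfolding m1 by (simp add: mult.commute)
      then have "int (p ^ (m - 1)) dvd int (p ^ (m - 2)) * int (p choose Suc i)"
        by (metis of_nat_dvd_iff of_nat_mult)
      then show ?thesis using 3 by (simp add: d_vec_def Wmod_def mod_eq_0_iff_dvd)
    qed
  qed
  finally show ?thesis .
qed

lemma twisted_norm_mult: "v \<in> A \<Longrightarrow> w \<in> A \<Longrightarrow> twisted_norm n (v \<otimes> w) = twisted_norm n v \<otimes> twisted_norm n w"
proof (induction n)
  case (Suc n)
  have "cj (twisted_norm n v) \<in> A" "cj (twisted_norm n w) \<in> A" using Suc.prems by auto
  then show ?case using Suc by (simp add: cj_mult m_assoc A_lcomm)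
qed simp

lemma cj_twisted_norm: "w \<in> A \<Longrightarrow> cj (twisted_norm n w) = twisted_norm n (cj w)"
  by (induction n) (auto simp: cj_mult)

text \<open>The second recursion adds the highest conjugate of \<open>w\<close> instead of
  \<open>w\<close> itself.\<close>

lemma twisted_norm_Suc': "w \<in> A \<Longrightarrow> twisted_norm (Suc n) w = twisted_norm n w \<otimes> (cj ^^ n) w"
proof (induction n)
  case (Suc n)
  have *: "(cj ^^ k) w \<in> A" for k using Suc.prems by (induction k) auto
  have "twisted_norm (Suc (Suc n)) w = cj (twisted_norm n w \<otimes> (cj ^^ n) w) \<otimes> w"
    using Suc by simp
  also have "\<dots> = cj (twisted_norm n w) \<otimes> (cj ^^ Suc n) w \<otimes> w"
    using Suc.prems *[of n] by (simp add: cj_mult)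
  also have "\<dots> = cj (twisted_norm n w) \<otimes> w \<otimes> (cj ^^ Suc n) w"
    using Suc.prems *[of "Suc n"] A_comm[of w "(cj ^^ Suc n) w"] by (simp add: m_assoc del: funpow.simps)
  finally show ?case by simp
qed simp

text \<open>Both recursions at p + 1, with norm N, give N(cj w) w = N(w) (cj^p w) = N(w) w. Hence N
  kills all commutators with \<open>b\<close>.\<close>

lemma twisted_norm_p_cj: "w \<in> A \<Longrightarrow> twisted_norm p (cj w) = twisted_norm p w"
proof -
  assume w: "w \<in> A"
  have "twisted_norm p (cj w) \<otimes> w = twisted_norm p w \<otimes> w"
    using twisted_norm_Suc'[OF w, of p] cj_iter_p[OF w] w by (simp add: cj_twisted_norm)
  then show ?thesis using w by simp
qed

end

section \<open>Critical groups from a presentation\<close>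

context cyclic_extension
begin

declare One_nat_def [simp del]

lemma psi_split: "psi p v = a [^] v 0 \<otimes> pow_prod G (\<lambda>i. c_seq (Suc i)) (p - 1) (\<lambda>i. v (Suc i))"
  using pow_prod_head[of "p - 1" c_seq v] p_gt_1 by auto

lemma psi_unit_vec: "psi p (\<lambda>i. if i = 0 then k else 0) = a [^] k"
proof -
  have "psi p (\<lambda>i. if i = 0 then k else 0) = a [^] k \<otimes> pow_prod G (\<lambda>i. c_seq (Suc i)) (p - 1) (\<lambda>i. 0)"
    by (subst psi_split) simp
  then show ?thesis using a_A by simp
qed

text \<open>Every later c_i is killed by p^(m-1), so only the \<open>a\<close>-coordinate
  contributes.\<close>

lemma psi_exp: "psi p v [^] (p ^ (m - 1)) = a [^] (v 0 * int (p ^ (m - 1)))"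
proof -
  let ?r = "pow_prod G (\<lambda>i. c_seq (Suc i)) (p - 1) (\<lambda>i. v (Suc i))"
  have r: "?r \<in> A" by auto
  have "?r [^] (p ^ (m - 1)) = \<one>"
    by (rule pow_prod_vanish) (auto simp: c_seq_Suc_exp)
  moreover have "psi p v [^] (p ^ (m - 1)) = (a [^] v 0) [^] (p ^ (m - 1)) \<otimes> ?r [^] (p ^ (m - 1))"
    unfolding psi_split using a_A r by (intro A_nat_pow_distrib) auto
  moreover have "(a [^] v 0) [^] (p ^ (m - 1)) = a [^] (v 0 * int (p ^ (m - 1)))"
    using a_A by (metis A_carrier int_pow_int int_pow_pow)
  ultimately show ?thesis using a_A by simp
qed

lemma psi_exp_one:
  assumes "int p dvd v 0"
  shows "psi p v [^] (p ^ (m - 1)) = \<one>"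
proof -
  obtain t where t: "v 0 = int p * t" using assms by blast
  have "p ^ m = p * p ^ (m - 1)" using m by (metis Suc_diff_1 less_le_trans pos2 power_Suc)
  then have "v 0 * int (p ^ (m - 1)) = int (p ^ m) * t" using t by simp
  then have "a [^] (v 0 * int (p ^ (m - 1))) = (a [^] int (p ^ m)) [^] t"
    using a_A by (simp add: int_pow_pow)
  also have "\<dots> = \<one>" using a_exp by (simp only: int_pow_int int_pow_one)
  finally show ?thesis by (simp add: psi_exp)
qed

lemma psi_d: "psi p (d_vec p m) = a [^] (p ^ (m - 1)) \<otimes> c_seq (p - 1) [^] (p ^ (m - 2))"
proof -
  obtain q where q: "p = Suc (Suc q)" using p_gt_1 by (metis Suc_lessE less_iff_Suc_add One_nat_def add_Suc_right)
  have "psi (Suc q) (d_vec p m) = c_seq 0 [^] d_vec p m 0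
      \<otimes> pow_prod G (\<lambda>i. c_seq (Suc i)) q (\<lambda>i. d_vec p m (Suc i))"
    by (rule pow_prod_head) auto
  also have "pow_prod G (\<lambda>i. c_seq (Suc i)) q (\<lambda>i. d_vec p m (Suc i)) = pow_prod G (\<lambda>i. c_seq (Suc i)) q (\<lambda>i. 0)"
    by (rule pow_prod_cong) (use q in \<open>auto simp: d_vec_def\<close>)
  also have "c_seq 0 [^] d_vec p m 0 = a [^] (p ^ (m - 1))"
    by (simp add: d_vec_def int_pow_int flip: of_nat_power)
  finally have "psi (Suc q) (d_vec p m) = a [^] (p ^ (m - 1))" using a_A by simp
  moreover have "c_seq (Suc q) [^] d_vec p m (Suc q) = c_seq (Suc q) [^] (p ^ (m - 2))"
  proof -
    have "Suc q = p - 1" using q by simp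
    then have "d_vec p m (Suc q) = int (p ^ (m - 2))" by (simp add: d_vec_def)
    then show ?thesis by (simp only: int_pow_int)
  qed
  moreover have "psi p (d_vec p m) = psi (Suc q) (d_vec p m) \<otimes> c_seq (Suc q) [^] d_vec p m (Suc q)"
    by (subst (1) q) (rule pow_prod.simps)
  ultimately show ?thesis using q by simp
qed

lemma b_pow_dvd_A: "p dvd k \<Longrightarrow> b [^] (k::nat) \<in> A"
  using b_pow_p by (auto simp flip: nat_pow_pow)

lemma b_pow_dvd_exp: "p dvd k \<Longrightarrow> (b [^] (k::nat)) [^] (p ^ (m - 1)) = \<one>"
  using b_exp by (simp add: nat_pow_pow mult.commute[of k] flip: nat_pow_pow[of b "p ^ (m - 1)"])

lemma cj_iter_A: "x \<in> A \<Longrightarrow> (cj ^^ n) x \<in> A"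
  by (induction n) auto

lemma mult_b_pow_cj: "x \<in> carrier G \<Longrightarrow> x \<otimes> b [^] n = b [^] n \<otimes> (cj ^^ n) x"
  by (simp add: cj_iter m_assoc inv_mult_cancel)

text \<open>Serves to normalise b^k w with k prime to \<open>p\<close>: a suitable power lies in the
  coset b A, where the norm formula applies.\<close>

lemma coset_pow:
  assumes w: "w \<in> A"
  shows "\<exists>w'\<in>A. (b [^] (k::nat) \<otimes> w) [^] (j::nat) = b [^] (k * j) \<otimes> w'"
proof (induction j)
  case (Suc j)
  then obtain w' where w': "w' \<in> A" "(b [^] k \<otimes> w) [^] j = b [^] (k * j) \<otimes> w'" by blast
  have c: "(cj ^^ k) w' \<in> A" using w' cj_iter_A by blast
  have "(b [^] k \<otimes> w) [^] Suc j = b [^] (k * j) \<otimes> (w' \<otimes> b [^] k) \<otimes> w"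
    using w w' by (simp add: m_assoc)
  also have "\<dots> = b [^] (k * j) \<otimes> b [^] k \<otimes> ((cj ^^ k) w' \<otimes> w)"
    using w w' c mult_b_pow_cj[of w' k] by (simp add: m_assoc)
  also have "b [^] (k * j) \<otimes> b [^] k = b [^] (k * Suc j)"
    by (simp add: nat_pow_mult add.commute)
  finally show ?case using w c by blast
qed (auto intro!: bexI[of _ \<one>])

end

text \<open>\<open>U\<close> and its quotients by members of \<open>U_NN\<close> are the instances.
  An element b^k \<open>psi p v\<close> lies in \<open>A\<close> exactly when \<open>p\<close>
  divides k.\<close>

locale presented_extension = cyclic_extension +
  assumes pG: "p_group p G"
    and b_notin_A: "b \<notin> A"
    and gen: "\<And>x. x \<in> carrier G \<Longrightarrow> \<exists>(k::nat) v. x = b [^] k \<otimes> psi p v"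
begin

lemma fin: "finite (carrier G)"
  using pG unfolding p_group_def by blast

lemma b_pow_A_iff: "b [^] (k::nat) \<in> A \<longleftrightarrow> p dvd k"
  using b_pow_dvd_A b_notin_A mem_subgroup_if_prime_pow[OF A_subgroup b_carrier p b_pow_p, of "int k"]
  by (auto simp: int_pow_int)

lemma gen_A:
  assumes "x \<in> A"
  obtains k :: nat and v where "x = b [^] k \<otimes> psi p v" "p dvd k"
proof -
  obtain k :: nat and v where x: "x = b [^] k \<otimes> psi p v" using gen assms by blast
  then have "b [^] k = x \<otimes> inv (psi p v)" using inv_solve_right' assms by (metis A_carrier b_carrier nat_pow_closed psi_A inv_solve_right)
  then have "b [^] k \<in> A" using assms by simp
  then show thesis using that x b_pow_A_iff by blast
qed

lemma gen_not_A:
  assumes "x \<in> carrier G" "x \<notin> A"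
  obtains k :: nat and v where "x = b [^] k \<otimes> psi p v" "\<not> p dvd k"
proof -
  obtain k :: nat and v where x: "x = b [^] k \<otimes> psi p v" using gen assms by blast
  then have "\<not> p dvd k" using assms b_pow_A_iff by auto
  then show thesis using that x by blast
qed

text \<open>The element \<open>y\<close> outside \<open>A\<close> has \<open>b\<close>-exponent k
  prime to \<open>p\<close>. Removing its psi-part puts b^k into \<open>K\<close>, and together with
  b^p this gives \<open>b\<close>.\<close>

lemma subgroup_with_A_eq_carrier:
  assumes K: "subgroup K G" and psiK: "\<And>v. psi p v \<in> K" and bp: "b [^] p \<in> K"
    and y: "y \<in> K" "y \<notin> A"
  shows "K = carrier G"
proof -
  have "y \<in> carrier G" by (rule subgroup.mem_carrier[OF K y(1)])
  then obtain k :: nat and v where k: "y = b [^] k \<otimes> psi p v" "\<not> p dvd k"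
    using gen_not_A y(2) by blast
  then have "b [^] k = y \<otimes> inv (psi p v)"
    using \<open>y \<in> carrier G\<close> by (simp add: m_assoc)
  then have "b [^] k \<in> K" using K y psiK by (simp add: subgroup.m_closed subgroup.m_inv_closed)
  then have b: "b \<in> K"
    using mem_subgroup_if_prime_pow[OF K b_carrier p bp, of "int k"] k by (simp add: int_pow_int)
  have "x \<in> K" if x: "x \<in> carrier G" for x
  proof -
    obtain j :: nat and u where "x = b [^] j \<otimes> psi p u" using gen x by blast
    moreover have "b [^] j \<in> K" using subgroup_int_pow_closed[OF K b, of "int j"] by (simp add: int_pow_int)
    ultimately show ?thesis using psiK K by (simp add: subgroup.m_closed)
  qed
  then show ?thesis using K subgroup.subset by blast
qed

lemma maximal_A: "maximal_subgroup A G"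
  unfolding maximal_subgroup_def
proof (intro conjI allI impI)
  show "A \<noteq> carrier G" using b_notin_A by auto
  fix K assume K: "subgroup K G \<and> A \<subseteq> K"
  show "K = A \<or> K = carrier G"
  proof (rule disjCI)
    assume "K \<noteq> carrier G"
    then have "K \<subseteq> A" using subgroup_with_A_eq_carrier[of K] K b_pow_p psi_A by blast
    then show "K = A" using K by blast
  qed
qed (rule A_subgroup)

text \<open>c_(i+1) is the commutator of \<open>inv b\<close> and c_i.\<close>

lemma c_seq_in_maximal:
  assumes "maximal_subgroup M G"
  shows "c_seq (Suc i) \<in> M"
proof -
  have "inv b \<otimes> c_seq i \<otimes> inv (inv b) \<otimes> inv (c_seq i) \<in> M"
    by (rule maximal_subgroup_commutator[OF p pG assms]) auto
  then show ?thesis by (simp add: comm_seq.simps)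
qed

end

text \<open>With \<open>a_exp\<close>, the first condition makes the order of \<open>a\<close>
  exactly p^m; the second is the relation obtained by dividing out \<open>U_D\<close>.\<close>

locale critical_presentation = presented_extension +
  assumes a_ord: "a [^] (p ^ (m - 1)) \<noteq> \<one>"
    and d_one: "psi p (d_vec p m) = \<one>"
begin

text \<open>The elements with this property form a subgroup. It contains \<open>a\<close> by
  \<open>ba_pow\<close> and \<open>d_one\<close>, the later c_i because the norm kills commutators
  with \<open>b\<close>, and b^p because its norm is b^(p^2). These generate
  \<open>A\<close>.\<close>

lemma twisted_norm_exp:
  assumes w: "w \<in> A"
  shows "twisted_norm p w [^] (p ^ (m - 2)) = \<one>"
proof -
  let ?S = "{w \<in> A. twisted_norm p w [^] (p ^ (m - 2)) = \<one>}"
  have one: "twisted_norm n \<one> = \<one>" for n by (induction n) auto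
  have S: "subgroup ?S G"
    by (rule subgroup_if_mult_closed[OF fin]) (auto simp: one twisted_norm_mult A_nat_pow_distrib)
  have "c_seq i \<in> ?S" for i
  proof (cases i)
    case 0
    have "twisted_norm p a [^] (p ^ (m - 2)) = \<one>"
      using mult_b_exp[OF a_A] ba_pow d_one by simp
    then show ?thesis using 0 a_A by simp
  next
    case (Suc j)
    have "twisted_norm p (c_seq j) \<otimes> twisted_norm p (c_seq (Suc j)) = twisted_norm p (c_seq j)"
      using twisted_norm_p_cj[of "c_seq j"] by (simp add: cj_c_seq twisted_norm_mult)
    then have "twisted_norm p (c_seq (Suc j)) = \<one>" by simp
    then show ?thesis using Suc by simp
  qed
  then have psi: "psi p v \<in> ?S" for v by (intro pow_prod_in S)
  have bp: "b [^] p \<in> ?S"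
  proof -
    have cb: "cj (b [^] p) = b [^] p"
      using nat_pow_Suc2[of b p] by (simp add: cj_def m_assoc inv_mult_cancel)
    have "twisted_norm n (b [^] p) = (b [^] p) [^] n" for n
    proof (induction n)
      case (Suc n)
      have "cj ((b [^] p) [^] n) = (b [^] p) [^] n"
        using cj_pow[OF b_pow_p, of "int n"] cb by (simp add: int_pow_int)
      then show ?case using Suc by simp
    qed simp
    then have "twisted_norm p (b [^] p) [^] (p ^ (m - 2)) = (b [^] (p ^ (m - 1))) [^] p"
    proof -
      have "p * p * p ^ (m - 2) = p ^ (m - 1) * p" by (simp add: p_pow_m1)
      then show ?thesis
        using \<open>\<And>n. twisted_norm n (b [^] p) = (b [^] p) [^] n\<close> by (simp only: nat_pow_pow b_carrier)
    qed
    then show ?thesis using b_exp b_pow_p by simp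
  qed
  obtain k :: nat and v where k: "w = b [^] k \<otimes> psi p v" "p dvd k"
    using gen_A w by blast
  obtain t where t: "k = p * t" using k by blast
  have "b [^] k \<in> ?S"
    using subgroup_int_pow_closed[OF S bp, of "int t"] by (simp add: t int_pow_int nat_pow_pow)
  then have "w \<in> ?S" using k psi subgroup.m_closed[OF S] by blast
  then show ?thesis by blast
qed

text \<open>The \<open>b\<close>-exponent k of \<open>x\<close> is prime to \<open>p\<close>. For j
  inverse to k modulo \<open>p\<close>, x^j lies in the coset b A, so the norm bound shows that
  p^(m-1) kills it. As j is prime to the order of \<open>x\<close>, p^(m-1) also kills
  \<open>x\<close>.\<close>

lemma exp_outside_A:
  assumes x: "x \<in> carrier G" "x \<notin> A"
  shows "x [^] (p ^ (m - 1)) = \<one>"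
proof -
  obtain k :: nat and v where k: "x = b [^] k \<otimes> psi p v" "\<not> p dvd k"
    using gen_not_A x by blast
  have cop: "coprime k p" using k(2) p by (metis prime_imp_coprime coprime_commute)
  have "k \<noteq> 0" using k(2) by (metis dvd_0_right)
  then obtain j t where jt: "k * j = p * t + 1"
    using bezout_nat[of k p] cop by auto
  obtain w where w: "w \<in> A" "x [^] j = b [^] (k * j) \<otimes> w"
    using coset_pow[of "psi p v" k j] k by auto
  have "x [^] j = b \<otimes> (b [^] (p * t) \<otimes> w)"
  proof -
    have "b [^] (p * t + 1) = b \<otimes> b [^] (p * t)" using nat_pow_Suc2[of b "p * t"] by (simp flip: Suc_eq_plus1)
    then show ?thesis using w jt by (simp add: m_assoc)
  qed
  moreover have "b [^] (p * t) \<otimes> w \<in> A" using b_pow_dvd_A w by auto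
  ultimately have "(x [^] j) [^] (p ^ (m - 1)) = \<one>"
    using mult_b_exp twisted_norm_exp by simp
  then have 1: "ord x dvd j * p ^ (m - 1)" using x by (simp add: nat_pow_pow pow_eq_id)
  obtain r where r: "order G = p ^ r" using pG unfolding p_group_def order_def by blast
  have "ord x dvd p ^ r" using ord_dvd_group_order[OF x(1)] r by simp
  then obtain s where s: "ord x = p ^ s" using divides_primepow_nat[OF p] by blast
  have "\<not> p dvd j"
  proof
    assume "p dvd j"
    then have "p dvd p * t + 1" using jt by (metis dvd_mult)
    then show False using p_gt_1 by (simp add: dvd_add_right_iff)
  qed
  then have "coprime (ord x) j" using s p by (simp add: prime_imp_coprime)
  then have "ord x dvd p ^ (m - 1)" using 1 by (simp add: coprime_dvd_mult_right_iff)
  then show ?thesis using x by (simp add: pow_eq_id)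
qed

lemma p_pow_m: "p ^ m = p ^ (m - 1) * p"
  using m by (metis Suc_diff_1 less_le_trans pos2 power_Suc2)

text \<open>Inside \<open>A\<close>, the \<open>p\<close>-th power has \<open>a\<close>-exponent
  divisible by \<open>p\<close> and therefore dies at p^(m-1), as does its
  \<open>b\<close>-part.\<close>

lemma exp_carrier:
  assumes x: "x \<in> carrier G"
  shows "x [^] (p ^ m) = \<one>"
proof (cases "x \<in> A")
  case False
  then have "(x [^] (p ^ (m - 1))) [^] p = \<one>" using exp_outside_A x by simp
  then show ?thesis using x by (simp add: nat_pow_pow p_pow_m)
next
  case True
  then obtain k :: nat and v where k: "x = b [^] k \<otimes> psi p v" "p dvd k"
    using gen_A by blast
  have "x [^] p = (b [^] k) [^] p \<otimes> psi p (\<lambda>i. int p * v i)"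
    using k b_pow_dvd_A by (simp add: A_nat_pow_distrib psi_scale int_pow_int)
  then have "(x [^] p) [^] (p ^ (m - 1)) =
      ((b [^] k) [^] p) [^] (p ^ (m - 1)) \<otimes> psi p (\<lambda>i. int p * v i) [^] (p ^ (m - 1))"
    using k b_pow_dvd_A by (simp add: A_nat_pow_distrib)
  also have "\<dots> = \<one>"
    using psi_exp_one[of "\<lambda>i. int p * v i"] b_pow_dvd_exp[of "k * p"] k by (simp add: nat_pow_pow)
  finally show ?thesis using x by (simp add: nat_pow_pow p_pow_m mult.commute)
qed

lemma grp_exp_carrier: "grp_exp G (carrier G) = p ^ m"
proof (rule dvd_antisym)
  show "grp_exp G (carrier G) dvd p ^ m"
    unfolding grp_exp_def by (rule Lcm_least) (auto simp: exp_carrier pow_eq_id[symmetric])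
  have "ord a dvd p ^ m" using a_exp a_A by (simp add: pow_eq_id)
  then obtain s where s: "ord a = p ^ s" "s \<le> m" using divides_primepow_nat[OF p] by blast
  have "\<not> s \<le> m - 1"
  proof
    assume "s \<le> m - 1"
    then have "ord a dvd p ^ (m - 1)" using s by (simp add: le_imp_power_dvd)
    then show False using a_ord a_A by (simp add: pow_eq_id)
  qed
  then have "s = m" using s by simp
  then have "ord a = p ^ m" using s by simp
  moreover have "ord a dvd grp_exp G (carrier G)"
    unfolding grp_exp_def using a_A by (intro dvd_Lcm) auto
  ultimately show "p ^ m dvd grp_exp G (carrier G)" by simp
qed

text \<open>A maximal subgroup contains \<open>a^p\<close>, \<open>b^p\<close> and all commutators, so with an element of order \<open>p^m\<close>
  it contains \<open>a\<close>, and with an element outside \<open>A\<close> also \<open>b\<close>.\<close>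

lemma exp_proper_nonabelian:
  assumes H: "subgroup H G" "H \<noteq> carrier G" and nab: "\<not> abelian_set G H" and x: "x \<in> H"
  shows "x [^] (p ^ (m - 1)) = \<one>"
proof (rule ccontr)
  assume neg: "x [^] (p ^ (m - 1)) \<noteq> \<one>"
  have xc: "x \<in> carrier G" by (rule subgroup.mem_carrier[OF H(1) x])
  then have xA: "x \<in> A" using neg exp_outside_A by blast
  obtain k :: nat and v where k: "x = b [^] k \<otimes> psi p v" "p dvd k"
    using gen_A xA by blast
  \<comment> \<open>Otherwise p^(m-1) would kill both the \<open>b\<close>-part and the psi-part of
    \<open>x\<close>.\<close>
  have v0: "\<not> int p dvd v 0"
  proof
    assume "int p dvd v 0"
    then have "x [^] (p ^ (m - 1)) = \<one>"
      using k b_pow_dvd_A by (simp add: A_nat_pow_distrib psi_exp_one b_pow_dvd_exp)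
    then show False using neg by simp
  qed
  obtain y where y: "y \<in> H" "y \<notin> A"
    using nab A_comm unfolding abelian_set_def by blast
  obtain M where M: "maximal_subgroup M G" "H \<subseteq> M"
    using maximal_subgroup_containing[OF fin H] by blast
  have MG: "subgroup M G" "M \<noteq> carrier G" using M unfolding maximal_subgroup_def by auto
  have pows: "z [^] p \<in> M" if "z \<in> carrier G" for z
    by (rule maximal_subgroup_pow[OF p pG M(1) that])
  obtain t where t: "k = p * t" using k by blast
  have bk: "b [^] k \<in> M"
    using subgroup_int_pow_closed[OF MG(1) pows[OF b_carrier], of "int t"] by (simp add: t int_pow_int nat_pow_pow)
  let ?r = "pow_prod G (\<lambda>i. c_seq (Suc i)) (p - 1)"
  have r: "?r u \<in> M" for u by (intro pow_prod_in MG c_seq_in_maximal M)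
  have rA: "?r u \<in> A" for u by auto
  have "x = b [^] k \<otimes> (a [^] v 0 \<otimes> ?r (\<lambda>i. v (Suc i)))" using k psi_split by simp
  \<comment> \<open>All other factors of \<open>x\<close> lie in \<open>M\<close>: b^k is a power of
    b^p, and the rest is built from commutators.\<close>
  then have "a [^] v 0 = inv (b [^] k) \<otimes> x \<otimes> inv (?r (\<lambda>i. v (Suc i)))"
    using a_A rA by (simp add: m_assoc inv_mult_cancel)
  then have "a [^] v 0 \<in> M" using bk r x M MG by (auto simp: subgroup.m_closed subgroup.m_inv_closed)
  then have "a \<in> M"
    using mem_subgroup_if_prime_pow[OF MG(1) _ p pows] v0 a_A by blast
  then have "psi p u \<in> M" for u
    unfolding psi_split using r MG subgroup_int_pow_closed by (simp add: subgroup.m_closed)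
  then have "M = carrier G"
    using subgroup_with_A_eq_carrier[OF MG(1) _ pows[OF b_carrier], of y] y M by blast
  then show False using MG by simp
qed

text \<open>\<open>exp_proper_nonabelian\<close> bounds the least common multiple by p^(m-1), while
  the exponent of \<open>G\<close> is p^m.\<close>

lemma exponent_critical_G: "exponent_critical G"
proof -
  let ?L = "Lcm {grp_exp G H | H. subgroup H G \<and> H \<noteq> carrier G \<and> \<not> abelian_set G H}"
  have "?L dvd p ^ (m - 1)"
  proof (rule Lcm_least, unfold mem_Collect_eq, elim exE conjE)
    fix e H assume H: "e = grp_exp G H" "subgroup H G" "H \<noteq> carrier G" "\<not> abelian_set G H"
    show "e dvd p ^ (m - 1)"
      unfolding H(1) grp_exp_def
    proof (rule Lcm_least, safe)
      fix x assume x: "x \<in> H"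
      then have "x [^] (p ^ (m - 1)) = \<one>" by (rule exp_proper_nonabelian[OF H(2-4)])
      moreover have "x \<in> carrier G" by (rule subgroup.mem_carrier[OF H(2) x])
      ultimately show "ord x dvd p ^ (m - 1)" by (simp add: pow_eq_id)
    qed
  qed
  moreover have "\<not> p ^ m dvd p ^ (m - 1)"
    using p_gt_1 m by (simp add: power_dvd_imp_le dvd_power_iff_le)
  ultimately have "p ^ m \<noteq> ?L" by metis
  then show ?thesis
    unfolding exponent_critical_def grp_exp_carrier using fin by (intro conjI)
qed

text \<open>If \<open>B\<close> is a second abelian maximal subgroup, then \<open>A \<inter> B\<close> is central; as it contains \<open>a^p\<close> and
  all \<open>c_(i+1)\<close>, this forces \<open>c_1^p = 1\<close> and \<open>c_i = 1\<close> for \<open>i \<ge> 2\<close>, against \<open>d = 1\<close>.\<close>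

lemma type_A_G:
  assumes "odd p \<or> m \<ge> 3"
  shows "type_A G"
  unfolding type_A_def
proof (rule ex1I[of _ A])
  show "maximal_subgroup A G \<and> abelian_set G A"
    using maximal_A A_comm unfolding abelian_set_def by blast
next
  fix B assume B: "maximal_subgroup B G \<and> abelian_set G B"
  show "B = A"
  proof (rule ccontr)
    assume ne: "B \<noteq> A"
    have BG: "subgroup B G" using B unfolding maximal_subgroup_def by blast
    obtain y where y: "y \<in> B" "y \<notin> A"
      using ne B maximal_A unfolding maximal_subgroup_def by blast
    have central: "cj z = z" if z: "z \<in> A" "z \<in> B" for z
    proof -
      \<comment> \<open>The centraliser of \<open>z\<close> contains b^p and all values of
        \<open>psi p\<close>, which lie in \<open>A\<close>, and also \<open>y\<close>, which lies
        in \<open>B\<close>; so it is the whole group.\<close>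
      let ?C = "{x \<in> carrier G. x \<otimes> z = z \<otimes> x}"
      have zc: "z \<in> carrier G" using z by blast
      have "subgroup ?C G"
      proof (rule subgroup_if_mult_closed[OF fin])
        fix u w assume u: "u \<in> ?C" "w \<in> ?C"
        then have "u \<otimes> w \<otimes> z = u \<otimes> (z \<otimes> w)" using zc by (simp add: m_assoc)
        also have "\<dots> = u \<otimes> z \<otimes> w" by (rule m_assoc[symmetric]) (use u zc in auto)
        also have "\<dots> = z \<otimes> (u \<otimes> w)" using u zc m_assoc[of z u w] by simp
        finally show "u \<otimes> w \<in> ?C" using u by simp
      qed (use zc in auto)
      moreover have "psi p v \<in> ?C" "b [^] p \<in> ?C" for v using z A_comm b_pow_p by auto
      moreover have "y \<in> ?C" using B y z BG unfolding abelian_set_def by (auto simp: subgroup.mem_carrier)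
      ultimately have "?C = carrier G" using subgroup_with_A_eq_carrier[of ?C y] y by blast
      then have "b \<otimes> z = z \<otimes> b" using b_carrier by blast
      then show ?thesis unfolding cj_def using zc by (simp add: m_assoc inv_mult_cancel flip: \<open>b \<otimes> z = z \<otimes> b\<close>)
    qed
    have c1: "c_seq (Suc 0) \<in> B" using c_seq_in_maximal B by blast
    have c2: "c_seq (Suc (Suc i)) = \<one>" for i
    proof -
      have "c_seq (Suc i) \<otimes> c_seq (Suc (Suc i)) = c_seq (Suc i)"
        using central[of "c_seq (Suc i)"] c_seq_in_maximal B cj_c_seq[of "Suc i"] by auto
      then show ?thesis by simp
    qed
    have "a [^] p \<in> B" using maximal_subgroup_pow[OF p pG] B a_A by blast
    then have "cj (a [^] p) = a [^] p" using central a_A by blast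
    moreover have "cj (a [^] p) = a [^] p \<otimes> c_seq (Suc 0) [^] p"
      using cj_pow[OF a_A, of "int p"] cj_c_seq[of 0] a_A by (simp add: int_pow_int A_nat_pow_distrib)
    ultimately have "a [^] p \<otimes> c_seq (Suc 0) [^] p = a [^] p" by simp
    then have c1p: "c_seq (Suc 0) [^] p = \<one>" using a_A by simp
    have "c_seq (p - 1) [^] (p ^ (m - 2)) = \<one>"
    \<comment> \<open>For p = 2 the index p - 1 is 1, and m \<ge> 3 leaves a factor \<open>p\<close>
      in p^(m-2). For odd \<open>p\<close> the index is at least 2 and the term is already
      trivial.\<close>
    proof (cases "p = 2")
      case True
      then have "m \<ge> 3" using assms by simp
      then have "p ^ (m - 2) = p * p ^ (m - 3)" by (metis Suc_diff_Suc Suc_le_eq numeral_2_eq_2 numeral_3_eq_3 power_Suc)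
      then have "c_seq (Suc 0) [^] (p ^ (m - 2)) = (c_seq (Suc 0) [^] p) [^] (p ^ (m - 3))"
        by (simp add: nat_pow_pow)
      then show ?thesis using True c1p by simp
    next
      case False
      then obtain i where "p - 1 = Suc (Suc i)" using p_gt_1
        by (metis One_nat_def Suc_1 Suc_diff_Suc Suc_lessI diff_zero less_imp_Suc_add)
      then show ?thesis using c2 by simp
    qed
    then have "a [^] (p ^ (m - 1)) = \<one>" using d_one a_A by (simp add: psi_d)
    then show False using a_ord by simp
  qed
qed

end

section \<open>The group U\<close>

lemma phi_lift_linear:
  "phi_lift p (\<lambda>i. c * v i + d * w i) = (\<lambda>i. c * phi_lift p v i + d * phi_lift p w i)"
  by (auto simp: phi_lift_def fun_eq_iff algebra_simps)

lemma phi_lift_pow_linear: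
  "(phi_lift p ^^ n) (\<lambda>i. c * v i + d * w i) = (\<lambda>i. c * (phi_lift p ^^ n) v i + d * (phi_lift p ^^ n) w i)"
  by (induction n) (simp_all add: phi_lift_linear)

lemma phi_lift_cong: "(\<And>i. i < p \<Longrightarrow> v i = w i) \<Longrightarrow> 0 < p \<Longrightarrow> phi_lift p v = phi_lift p w"
  by (auto simp: phi_lift_def fun_eq_iff)

definition unit_vec :: "nat \<Rightarrow> nat \<Rightarrow> int" where
  "unit_vec k = (\<lambda>i. if i = k then 1 else 0)"

lemma phi_lift_unit_vec:
  assumes "Suc k < p"
  shows "phi_lift p (unit_vec k) = (\<lambda>i. unit_vec k i + unit_vec (Suc k) i)"
proof
  fix i show "phi_lift p (unit_vec k) i = unit_vec k i + unit_vec (Suc k) i"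
    using assms by (cases i) (auto simp: phi_lift_def unit_vec_def)
qed

text \<open>Below degree \<open>p\<close> no reduction takes place, so the iterate is just (1 +
  X)^n.\<close>

lemma phi_lift_pow_unit_vec_0:
  assumes "n < p"
  shows "(phi_lift p ^^ n) (unit_vec 0) = (\<lambda>i. if i < p then int (n choose i) else 0)"
  using assms
proof (induction n)
  case 0
  then show ?case by (auto simp: unit_vec_def fun_eq_iff binomial_eq_0)
next
  case (Suc n)
  have "phi_lift p (\<lambda>i. if i < p then int (n choose i) else 0) i = (if i < p then int (Suc n choose i) else 0)" for i
    using Suc.prems by (cases i) (auto simp: phi_lift_def binomial_eq_0)
  then show ?case using Suc by auto
qed

text \<open>This is (1 + X)^p = 1. The vectors fixed by the \<open>p\<close>-th iterate contain the
  unit vector 0 and are closed under linear combinations and \<open>phi_lift\<close>; unit vector k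
  + 1 is the image of unit vector k minus that vector. Entries from index \<open>p\<close> on are
  erased, hence the bound on \<open>i\<close>.\<close>

lemma phi_lift_order:
  assumes "0 < p" "i < p"
  shows "(phi_lift p ^^ p) v i = v i"
proof -
  define S where "S = {v. \<forall>i<p. (phi_lift p ^^ p) v i = v i}"
  have lin: "(\<lambda>i. c * v i + d * w i) \<in> S" if "v \<in> S" "w \<in> S" for c d v w
    using that unfolding S_def by (simp add: phi_lift_pow_linear)
  have phi: "phi_lift p v \<in> S" if "v \<in> S" for v
  proof -
    have "(phi_lift p ^^ p) (phi_lift p v) = phi_lift p ((phi_lift p ^^ p) v)"
      by (simp add: funpow_swap1)
    also have "\<dots> = phi_lift p v"
      using that assms(1) unfolding S_def by (intro phi_lift_cong) auto
    finally show ?thesis unfolding S_def by simp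
  qed
  have e: "unit_vec k \<in> S" if "k < p" for k
    using that
  proof (induction k)
    case 0
    obtain q where q: "p = Suc q" using assms(1) by (cases p) auto
    \<comment> \<open>The last application wraps around: the top coefficient is 1, and for i \<ge> 1
      the sum of q choose i and q choose (i - 1) is cancelled by p choose i.\<close>
    have "phi_lift p (\<lambda>i. if i < p then int (q choose i) else 0) i = unit_vec 0 i" if "i < p" for i
      using that q by (cases i) (auto simp: phi_lift_def unit_vec_def)
    moreover have "(phi_lift p ^^ p) (unit_vec 0) = phi_lift p (\<lambda>i. if i < p then int (q choose i) else 0)"
      using phi_lift_pow_unit_vec_0[of q p] q by simp
    ultimately show ?case unfolding S_def by simp
  next
    case (Suc k)
    have eq: "unit_vec (Suc k) = (\<lambda>i. 1 * phi_lift p (unit_vec k) i + (-1) * unit_vec k i)"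
      using Suc.prems by (simp add: phi_lift_unit_vec)
    show ?case unfolding eq by (intro lin phi Suc.IH) (use Suc.prems in simp_all)
  qed
  have t: "(\<lambda>i. if i < n then v i else 0) \<in> S" if "n \<le> p" for n
    using that
  proof (induction n)
    case 0
    have "(\<lambda>i. 0 * unit_vec 0 i + 0 * unit_vec 0 i) \<in> S" using assms(1) by (intro lin e)
    then show ?case by simp
  next
    case (Suc n)
    have eq: "(\<lambda>i. if i < Suc n then v i else 0) = (\<lambda>i. 1 * (if i < n then v i else 0) + v n * unit_vec n i)"
      by (auto simp: fun_eq_iff unit_vec_def less_Suc_eq)
    show ?case unfolding eq by (intro lin e Suc.IH) (use Suc.prems in simp_all)
  qed
  obtain q where q: "p = Suc q" using assms(1) by (cases p) auto
  \<comment> \<open>One application of \<open>phi_lift\<close> already ignores the entries from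
    \<open>p\<close> on, so \<open>v\<close> may be truncated to a combination of unit
    vectors.\<close>
  have "(phi_lift p ^^ p) v = (phi_lift p ^^ q) (phi_lift p v)"
    using q by (simp add: funpow_swap1)
  also have "phi_lift p v = phi_lift p (\<lambda>i. if i < p then v i else 0)"
    by (rule phi_lift_cong) (use assms in auto)
  also have "(phi_lift p ^^ q) \<dots> = (phi_lift p ^^ p) (\<lambda>i. if i < p then v i else 0)"
    using q by (simp add: funpow_swap1)
  finally show ?thesis using t[of p] assms(2) unfolding S_def by simp
qed

section \<open>The abelian group W, the automorphism phi and the group law of
  \<open>U\<close>\<close>

locale U_params =
  fixes p m :: nat
  assumes p: "Factorial_Ring.prime p" and m: "2 \<le> m"
begin

abbreviation U where "U \<equiv> U_grp p m"

abbreviation q where "q \<equiv> p ^ (m - 1)"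

lemma p_gt_1: "p > 1"
  using p prime_gt_1_nat by blast

lemma p_dvd_q: "p dvd q"
  using m by (intro dvd_power) auto

lemma q_gt_1: "q > 1"
  using p_gt_1 m by (intro one_less_power) auto

text \<open>Canonical representative in W of an integral vector. Elements of W are their own
  reductions, so identities in W follow from identities between integral vectors.\<close>

definition red :: "(nat \<Rightarrow> int) \<Rightarrow> nat \<Rightarrow> int" where
  "red v = (\<lambda>i. if i < p then v i mod Wmod p m i else 0)"

lemma Wmod_pos: "Wmod p m i > 0"
  using p_gt_1 by (simp add: Wmod_def)

text \<open>phi feeds coordinate 0, taken modulo p^m, into coordinate 1, taken modulo p^(m-1); the
  divisibility makes this well defined.\<close>

lemma Wmod_dvd_0: "Wmod p m i dvd Wmod p m 0"
  by (simp add: Wmod_def le_imp_power_dvd)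

lemma red_Wcarrier [simp, intro]: "red v \<in> Wcarrier p m"
  using Wmod_pos by (auto simp: red_def Wcarrier_def)

lemma red_id: "w \<in> Wcarrier p m \<Longrightarrow> red w = w"
  by (auto simp: red_def Wcarrier_def fun_eq_iff)

lemma red_cong: "(\<And>i. i < p \<Longrightarrow> v i mod Wmod p m i = w i mod Wmod p m i) \<Longrightarrow> red v = red w"
  by (auto simp: red_def)

lemma red_zero: "red (\<lambda>i. 0) = (\<lambda>i. 0)"
  by (auto simp: red_def)

lemma Wplus_red: "Wplus p m (red v) (red w) = red (\<lambda>i. v i + w i)"
  by (auto simp: Wplus_def red_def fun_eq_iff mod_add_eq)

lemma Wphi_red: "Wphi p m (red v) = red (phi_lift p v)"
proof
  fix i
  show "Wphi p m (red v) i = red (phi_lift p v) i"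
  proof (cases "i = 0 \<or> p \<le> i")
    case True
    then show ?thesis using p_gt_1 by (auto simp: Wphi_def red_def phi_lift_def)
  next
    case False
    let ?M = "Wmod p m i"
    have i: "0 < i" "i < p" using False by auto
    have 1: "red v j mod ?M = v j mod ?M" if "j < p" for j
      using that Wmod_dvd_0[of i] i by (auto simp: red_def Wmod_def mod_mod_cancel split: if_splits)
    have "(red v i + red v (i - 1) - int (p choose i) * red v (p - 1)) mod ?M =
        (v i + v (i - 1) - int (p choose i) * v (p - 1)) mod ?M"
      using i p_gt_1 by (intro mod_diff_cong mod_add_cong mod_mult_cong refl 1) auto
    then show ?thesis using i by (simp add: Wphi_def phi_lift_def) (simp add: red_def phi_lift_def)
  qed
qed

lemma Wphi_pow_red: "(Wphi p m ^^ n) (red v) = red ((phi_lift p ^^ n) v)"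
  by (induction n) (auto simp: Wphi_red)

lemma Wphi_pow_closed: "w \<in> Wcarrier p m \<Longrightarrow> (Wphi p m ^^ n) w \<in> Wcarrier p m"
  using Wphi_pow_red[of n w] red_id by auto

lemma Wphi_pow_p: "w \<in> Wcarrier p m \<Longrightarrow> (Wphi p m ^^ p) w = w"
proof -
  assume w: "w \<in> Wcarrier p m"
  have "red ((phi_lift p ^^ p) w) = red w"
    using p_gt_1 by (intro red_cong) (simp add: phi_lift_order)
  then show ?thesis using Wphi_pow_red[of p w] red_id[OF w] by simp
qed

lemma Wphi_pow_dvd: "w \<in> Wcarrier p m \<Longrightarrow> p dvd n \<Longrightarrow> (Wphi p m ^^ n) w = w"
  using funpow_mod_eq[where f = "Wphi p m" and n = p and m = n and x = w] Wphi_pow_p by simp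

text \<open>As \<open>p\<close> divides \<open>q\<close> and phi^p = 1, reducing the exponent of
  \<open>b0\<close> modulo \<open>q\<close> does not change the action; associativity of
  \<open>U\<close> rests on this.\<close>

lemma Wphi_pow_mod: "w \<in> Wcarrier p m \<Longrightarrow> (Wphi p m ^^ (n mod q)) w = (Wphi p m ^^ n) w"
  by (rule funpow_mod_eq) (rule Wphi_pow_dvd[OF _ p_dvd_q])

lemma Wphi_pow_plus:
  assumes "v \<in> Wcarrier p m" "w \<in> Wcarrier p m"
  shows "(Wphi p m ^^ n) (Wplus p m v w) = Wplus p m ((Wphi p m ^^ n) v) ((Wphi p m ^^ n) w)"
proof -
  have "(Wphi p m ^^ n) (Wplus p m (red v) (red w)) =
      Wplus p m ((Wphi p m ^^ n) (red v)) ((Wphi p m ^^ n) (red w))"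
    using phi_lift_pow_linear[of n p 1 v 1 w] by (simp add: Wplus_red Wphi_pow_red)
  then show ?thesis using assms by (simp add: red_id)
qed

lemma Wplus_closed [simp, intro]: "v \<in> Wcarrier p m \<Longrightarrow> w \<in> Wcarrier p m \<Longrightarrow> Wplus p m v w \<in> Wcarrier p m"
  using Wplus_red[of v w] red_id by (metis red_Wcarrier)

lemma Wplus_assoc:
  assumes "u \<in> Wcarrier p m" "v \<in> Wcarrier p m" "w \<in> Wcarrier p m"
  shows "Wplus p m (Wplus p m u v) w = Wplus p m u (Wplus p m v w)"
proof -
  have "Wplus p m (Wplus p m (red u) (red v)) (red w) = Wplus p m (red u) (Wplus p m (red v) (red w))"
    by (simp add: Wplus_red add.assoc)
  then show ?thesis using assms by (simp add: red_id)
qed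

lemma Wplus_comm: "Wplus p m u v = Wplus p m v u"
  by (auto simp: Wplus_def add.commute)

lemma W_zero [simp]: "(\<lambda>i. 0) \<in> Wcarrier p m"
  using red_Wcarrier[of "\<lambda>i. 0"] red_zero by simp

lemma Wplus_zero [simp]: "w \<in> Wcarrier p m \<Longrightarrow> Wplus p m (\<lambda>i. 0) w = w"
  "w \<in> Wcarrier p m \<Longrightarrow> Wplus p m w (\<lambda>i. 0) = w"
  using red_id[of w] by (simp_all add: Wplus_def red_def cong: if_cong)

lemma Wphi_pow_zero [simp]: "(Wphi p m ^^ n) (\<lambda>i. 0) = (\<lambda>i. 0)"
  by (induction n) (auto simp: Wphi_def)

lemma Wphi_zero [simp]: "Wphi p m (\<lambda>i. 0) = (\<lambda>i. 0)"
  using Wphi_pow_zero[of 1] by simp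

lemma U_carrier: "carrier U = {..<q} \<times> Wcarrier p m"
  by (simp add: U_grp_def)

lemma U_mult_eq: "(k, v) \<otimes>\<^bsub>U\<^esub> (l, w) = ((k + l) mod q, Wplus p m ((Wphi p m ^^ l) v) w)"
  by (simp add: U_grp_def U_mult_def)

lemma U_one: "\<one>\<^bsub>U\<^esub> = (0, \<lambda>i. 0)"
  by (simp add: U_grp_def)

lemma U_group: "group U"
proof (rule groupI)
  fix x y assume "x \<in> carrier U" "y \<in> carrier U"
  then show "x \<otimes>\<^bsub>U\<^esub> y \<in> carrier U"
    using p_gt_1 by (auto simp: U_carrier U_mult_eq Wphi_pow_closed intro!: mod_less_divisor)
next
  show "\<one>\<^bsub>U\<^esub> \<in> carrier U" using p_gt_1 by (simp add: U_carrier U_one)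
next
  fix x y z assume "x \<in> carrier U" "y \<in> carrier U" "z \<in> carrier U"
  then obtain k u l v n w where xyz: "x = (k, u)" "y = (l, v)" "z = (n, w)"
    and W: "u \<in> Wcarrier p m" "v \<in> Wcarrier p m" "w \<in> Wcarrier p m"
    by (auto simp: U_carrier)
  have "(Wphi p m ^^ n) ((Wphi p m ^^ l) u) = (Wphi p m ^^ ((l + n) mod q)) u"
    using Wphi_pow_mod[OF W(1), of "l + n"] by (simp add: add.commute[of l] funpow_add)
  then have "(Wphi p m ^^ n) (Wplus p m ((Wphi p m ^^ l) u) v) =
      Wplus p m ((Wphi p m ^^ ((l + n) mod q)) u) ((Wphi p m ^^ n) v)"
    using W by (simp add: Wphi_pow_plus Wphi_pow_closed)
  then show "x \<otimes>\<^bsub>U\<^esub> y \<otimes>\<^bsub>U\<^esub> z = x \<otimes>\<^bsub>U\<^esub> (y \<otimes>\<^bsub>U\<^esub> z)"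
    using W by (simp add: xyz U_mult_eq Wplus_assoc Wphi_pow_closed mod_simps add.assoc)
next
  fix x assume "x \<in> carrier U"
  then show "\<one>\<^bsub>U\<^esub> \<otimes>\<^bsub>U\<^esub> x = x"
    by (auto simp: U_carrier U_one U_mult_eq)
next
  fix x assume "x \<in> carrier U"
  then obtain k w where x: "x = (k, w)" "k < q" "w \<in> Wcarrier p m" by (auto simp: U_carrier)
  \<comment> \<open>The inverse of b0^k w is b0^(-k) phi^(-k)(w^(-1)), with -k represented by q - k;
    the outer \<open>mod\<close> covers k = 0.\<close>
  let ?y = "((q - k) mod q, red (\<lambda>i. - (Wphi p m ^^ (q - k)) w i))"
  have "(Wphi p m ^^ k) (red (\<lambda>i. - (Wphi p m ^^ (q - k)) w i)) = red (\<lambda>i. - w i)"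
  proof -
    have w: "w = red w" using x red_id by simp
    have "red (\<lambda>i. - (Wphi p m ^^ (q - k)) w i) = red (\<lambda>i. - ((phi_lift p ^^ (q - k)) w) i)"
      by (subst w, subst Wphi_pow_red) (rule red_cong, auto simp: red_def mod_minus_eq)
    then have "(Wphi p m ^^ k) (red (\<lambda>i. - (Wphi p m ^^ (q - k)) w i)) =
        red ((phi_lift p ^^ k) (\<lambda>i. - ((phi_lift p ^^ (q - k)) w) i))"
      by (simp add: Wphi_pow_red)
    also have "(phi_lift p ^^ k) (\<lambda>i. - ((phi_lift p ^^ (q - k)) w) i) = (\<lambda>i. - (phi_lift p ^^ q) w i)"
      using phi_lift_pow_linear[of k p "-1" "(phi_lift p ^^ (q - k)) w" 0 "\<lambda>i. 0"] x(2)
        funpow_add[of k "q - k" "phi_lift p"] by simp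
    also have "red (\<lambda>i. - (phi_lift p ^^ q) w i) = red (\<lambda>i. - red ((phi_lift p ^^ q) w) i)"
      by (rule red_cong) (auto simp: red_def mod_minus_eq)
    also have "red ((phi_lift p ^^ q) w) = w"
      using Wphi_pow_red[of q w] w Wphi_pow_dvd[OF x(3) p_dvd_q] by simp
    finally show ?thesis .
  qed
  moreover have "Wplus p m (red (\<lambda>i. - w i)) w = (\<lambda>i. 0)"
    using Wplus_red[of "\<lambda>i. - w i" w] x red_id[of w] red_zero by simp
  ultimately have "?y \<otimes>\<^bsub>U\<^esub> x = \<one>\<^bsub>U\<^esub>"
    using x by (simp add: U_mult_eq U_one mod_simps)
  moreover have "?y \<in> carrier U" using p_gt_1 by (auto simp: U_carrier intro!: mod_less_divisor)
  ultimately show "\<exists>y\<in>carrier U. y \<otimes>\<^bsub>U\<^esub> x = \<one>\<^bsub>U\<^esub>" by blast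
qed

lemma card_Wcarrier: "finite (Wcarrier p m) \<and> (\<exists>k. card (Wcarrier p m) = p ^ k)"
proof -
  let ?P = "PiE {..<p} (\<lambda>i. {0..<Wmod p m i})"
  \<comment> \<open>Vectors of W are 0 from index \<open>p\<close> on, while functions in
    \<open>PiE\<close> are \<open>undefined\<close> there; the two maps only exchange these default
    values.\<close>
  have "bij_betw (\<lambda>w. restrict w {..<p}) (Wcarrier p m) ?P"
  proof (rule bij_betw_byWitness[where f' = "\<lambda>w i. if i < p then w i else 0"])
    show "\<forall>w\<in>Wcarrier p m. (\<lambda>i. if i < p then restrict w {..<p} i else 0) = w"
      by (auto simp: Wcarrier_def fun_eq_iff)
    show "\<forall>w\<in>?P. restrict (\<lambda>i. if i < p then w i else 0) {..<p} = w"
      by (auto simp: PiE_def extensional_def fun_eq_iff)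
  qed (auto simp: Wcarrier_def PiE_def Pi_def)
  then have "finite (Wcarrier p m) = finite ?P" "card (Wcarrier p m) = card ?P"
    by (rule bij_betw_finite, rule bij_betw_same_card)
  moreover have "finite ?P" by (rule finite_PiE) auto
  moreover have "card ?P = (\<Prod>i<p. p ^ (if i = 0 then m else m - 1))"
    by (simp add: card_PiE Wmod_def nat_power_eq if_distrib cong: if_cong)
  then have "card ?P = p ^ (\<Sum>i<p. if i = 0 then m else m - 1)" by (simp only: power_sum)
  ultimately show ?thesis by auto
qed

lemma U_p_group: "p_group p U"
proof -
  obtain k where "card (Wcarrier p m) = p ^ k" using card_Wcarrier by blast
  then have "card (carrier U) = p ^ (m - 1 + k)" by (simp add: U_carrier power_add card_cartesian_product)
  then show ?thesis unfolding p_group_def using U_group card_Wcarrier by (auto simp: U_carrier)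
qed

section \<open>The abelian maximal subgroup of \<open>U\<close> and the relations in
  \<open>U\<close>\<close>

definition A0 where "A0 = {x \<in> carrier U. p dvd fst x}"

definition b0 :: "nat \<times> (nat \<Rightarrow> int)" where "b0 = (1, \<lambda>i. 0)"

sublocale U: group U by (rule U_group)

lemma b0_carrier: "b0 \<in> carrier U"
  using q_gt_1 by (simp add: b0_def U_carrier)

lemma a0_eq: "U_a0 p m = (0, red (unit_vec 0))"
  using p_gt_1 m by (auto simp: U_a0_def red_def unit_vec_def fun_eq_iff Wmod_def)

lemma W_mult: "(0, red v) \<otimes>\<^bsub>U\<^esub> (0, red w) = (0, red (\<lambda>i. v i + w i))"
  by (simp add: U_mult_eq Wplus_red)

lemma W_carrier: "(0, red v) \<in> carrier U"
  using p_gt_1 by (simp add: U_carrier)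

lemma W_nat_pow: "(0, red v) [^]\<^bsub>U\<^esub> (n::nat) = (0, red (\<lambda>i. int n * v i))"
  by (induction n) (simp_all add: U_one red_zero W_mult algebra_simps)

lemma W_inv: "inv\<^bsub>U\<^esub> (0, red v) = (0, red (\<lambda>i. - v i))"
  by (rule U.inv_equality) (simp_all add: W_mult W_carrier U_one red_zero)

lemma W_int_pow: "(0, red v) [^]\<^bsub>U\<^esub> (n::int) = (0, red (\<lambda>i. n * v i))"
proof (cases n)
  case (nonneg k)
  then show ?thesis by (simp only: int_pow_int W_nat_pow)
next
  case (neg k)
  then have "(0, red v) [^]\<^bsub>U\<^esub> n = inv\<^bsub>U\<^esub> ((0, red v) [^]\<^bsub>U\<^esub> Suc k)"
    by (simp only: neg U.int_pow_neg_int[OF W_carrier])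
  also have "\<dots> = (0, red (\<lambda>i. n * v i))"
    by (simp only: W_nat_pow W_inv neg mult_minus_left)
  finally show ?thesis .
qed

lemma b0_pow: "b0 [^]\<^bsub>U\<^esub> (n::nat) = (n mod q, \<lambda>i. 0)"
  by (induction n) (auto simp: U_one U_mult_eq b0_def mod_simps)

text \<open>The \<open>b0\<close>-part commutes with \<open>b0\<close>, so conjugation moves only
  the W-part, by phi.\<close>

lemma conj_b0:
  assumes "(k, w) \<in> carrier U"
  shows "inv\<^bsub>U\<^esub> b0 \<otimes>\<^bsub>U\<^esub> (k, w) \<otimes>\<^bsub>U\<^esub> b0 = (k, Wphi p m w)"
proof -
  have w: "w \<in> Wcarrier p m" "Wphi p m w \<in> Wcarrier p m"
    using assms Wphi_pow_closed[of w 1] by (auto simp: U_carrier)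
  have "(k, w) \<otimes>\<^bsub>U\<^esub> b0 = b0 \<otimes>\<^bsub>U\<^esub> (k, Wphi p m w)"
    using w by (simp add: U_mult_eq b0_def)
  moreover have "(k, Wphi p m w) \<in> carrier U" using assms w by (simp add: U_carrier)
  ultimately show ?thesis
    using assms b0_carrier by (simp add: U.m_assoc U.inv_mult_cancel)
qed

text \<open>Powers of \<open>b0\<close> with exponent divisible by \<open>p\<close> act trivially on
  W.\<close>

lemma A0_comm:
  assumes "x \<in> A0" "y \<in> A0"
  shows "x \<otimes>\<^bsub>U\<^esub> y = y \<otimes>\<^bsub>U\<^esub> x"
  using assms
  by (cases x; cases y) (simp add: A0_def U_carrier U_mult_eq Wphi_pow_dvd Wplus_comm add.commute)

lemma A0_subgroup: "subgroup A0 U"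
proof (rule U.subgroup_if_mult_closed)
  show "finite (carrier U)" using U_p_group unfolding p_group_def by blast
  show "\<one>\<^bsub>U\<^esub> \<in> A0" by (simp add: A0_def) (simp add: U_one)
  fix x y assume "x \<in> A0" "y \<in> A0"
  then show "x \<otimes>\<^bsub>U\<^esub> y \<in> A0"
    using U.m_closed[of x y] p_dvd_q by (cases x; cases y) (auto simp: A0_def U_mult_eq dvd_mod)
qed (auto simp: A0_def)

text \<open>The commutator is the vector phi(w) - w of W. As phi fixes coordinate 0, only
  coordinates of modulus \<open>q\<close> can be nonzero.\<close>

lemma U_commutator_exp:
  assumes "x \<in> A0"
  shows "(inv\<^bsub>U\<^esub> b0 \<otimes>\<^bsub>U\<^esub> x \<otimes>\<^bsub>U\<^esub> b0 \<otimes>\<^bsub>U\<^esub> inv\<^bsub>U\<^esub> x) [^]\<^bsub>U\<^esub> q = \<one>\<^bsub>U\<^esub>"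
proof -
  obtain k w where x: "x = (k, w)" "p dvd k" "w \<in> Wcarrier p m" "(k, w) \<in> carrier U"
    using assms by (auto simp: A0_def U_carrier)
  let ?v = "\<lambda>i. phi_lift p w i - w i"
  have w: "w = red w" using x red_id by simp
  have "(0, red ?v) \<otimes>\<^bsub>U\<^esub> x = (k, red (phi_lift p w))"
    using x Wplus_red[of ?v w] w Wphi_pow_dvd[of "red ?v" k] by (simp add: U_mult_eq U_carrier)
  also have "\<dots> = inv\<^bsub>U\<^esub> b0 \<otimes>\<^bsub>U\<^esub> x \<otimes>\<^bsub>U\<^esub> b0"
    using conj_b0[OF x(4)] Wphi_red[of w] w x(1) by simp
  finally have eq: "(0, red ?v) \<otimes>\<^bsub>U\<^esub> x = inv\<^bsub>U\<^esub> b0 \<otimes>\<^bsub>U\<^esub> x \<otimes>\<^bsub>U\<^esub> b0" .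
  have "inv\<^bsub>U\<^esub> b0 \<otimes>\<^bsub>U\<^esub> x \<otimes>\<^bsub>U\<^esub> b0 \<otimes>\<^bsub>U\<^esub> inv\<^bsub>U\<^esub> x = (0, red ?v)"
    using x(1,4) W_carrier[of ?v] unfolding eq[symmetric] by (simp add: U.m_assoc)
  moreover have "red (\<lambda>i. int q * ?v i) = (\<lambda>i. 0)"
    by (auto simp: red_def fun_eq_iff phi_lift_def Wmod_def)
  ultimately show ?thesis by (simp add: W_nat_pow U_one del: of_nat_power)
qed

sublocale UE: cyclic_extension U A0 "U_a0 p m" b0 p m
proof (intro cyclic_extension.intro abelian_subgroup.intro abelian_subgroup_axioms.intro
    cyclic_extension_axioms.intro)
  show "b0 [^]\<^bsub>U\<^esub> p \<in> A0"
    using U.nat_pow_closed[OF b0_carrier, of p] p_dvd_q by (simp add: A0_def) (simp add: b0_pow dvd_mod)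
  show "b0 [^]\<^bsub>U\<^esub> q = \<one>\<^bsub>U\<^esub>" by (simp add: b0_pow U_one)
  have "red (\<lambda>i. int (p ^ m) * unit_vec 0 i) = (\<lambda>i. 0)"
    by (auto simp: red_def unit_vec_def Wmod_def fun_eq_iff)
  then show "U_a0 p m [^]\<^bsub>U\<^esub> (p ^ m) = \<one>\<^bsub>U\<^esub>"
    by (simp add: a0_eq W_nat_pow U_one del: of_nat_power)
  show "U_a0 p m \<in> A0" using W_carrier by (simp add: a0_eq A0_def)
  fix x assume x: "x \<in> A0"
  then show "inv\<^bsub>U\<^esub> b0 \<otimes>\<^bsub>U\<^esub> x \<otimes>\<^bsub>U\<^esub> b0 \<in> A0"
    using Wphi_pow_closed[of "snd x" 1] by (cases x) (auto simp: A0_def conj_b0 U_carrier)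
qed (fact U_group A0_subgroup A0_comm p m b0_carrier U_commutator_exp)+

text \<open>In \<open>U\<close> the commutator sequence recovers the generators a_k, because phi
  maps unit vector k to the sum of unit vectors k and k + 1.\<close>

lemma U_c_seq: "k < p \<Longrightarrow> UE.c_seq k = (0, red (unit_vec k))"
proof (induction k)
  case 0
  then show ?case by (simp add: a0_eq)
next
  case (Suc k)
  have "UE.c_seq (Suc k) = (0, Wphi p m (red (unit_vec k))) \<otimes>\<^bsub>U\<^esub> (0, red (\<lambda>i. - unit_vec k i))"
    using Suc W_carrier by (simp add: comm_seq.simps conj_b0 W_inv)
  also have "\<dots> = (0, red (unit_vec (Suc k)))"
    using Suc.prems by (simp add: Wphi_red phi_lift_unit_vec W_mult)
  finally show ?case .
qed

lemma U_psi:
  assumes "n \<le> p"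
  shows "UE.psi n v = (0, red (\<lambda>i. if i < n then v i else 0))"
  using assms
proof (induction n)
  case 0
  then show ?case by (simp add: U_one red_zero)
next
  case (Suc n)
  have "(\<lambda>i. (if i < n then v i else 0) + v n * unit_vec n i) = (\<lambda>i. if i < Suc n then v i else 0)"
    by (auto simp: unit_vec_def fun_eq_iff less_Suc_eq)
  then show ?case using Suc by (simp add: U_c_seq W_int_pow W_mult)
qed

lemma U_psi_p: "UE.psi p v = (0, red v)"
  using U_psi[of p v] by (auto simp: red_def fun_eq_iff cong: if_cong)

lemma U_gen:
  assumes "(k, w) \<in> carrier U"
  shows "(k, w) = b0 [^]\<^bsub>U\<^esub> k \<otimes>\<^bsub>U\<^esub> UE.psi p w"
  using assms red_id[of w] by (simp add: U_psi_p b0_pow U_mult_eq U_carrier)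

lemma b0_notin_A0: "b0 \<notin> A0"
proof
  assume "b0 \<in> A0"
  then have "p dvd 1" by (simp only: A0_def b0_def mem_Collect_eq fst_conv)
  then show False using p_gt_1 by (simp only: nat_dvd_1_iff_1)
qed

sublocale UP: presented_extension U A0 "U_a0 p m" b0 p m
proof (intro presented_extension.intro presented_extension_axioms.intro)
  fix x assume x: "x \<in> carrier U"
  then have "x = b0 [^]\<^bsub>U\<^esub> fst x \<otimes>\<^bsub>U\<^esub> UE.psi p (snd x)"
    using U_gen[of "fst x" "snd x"] by simp
  then show "\<exists>(k::nat) v. x = b0 [^]\<^bsub>U\<^esub> k \<otimes>\<^bsub>U\<^esub> UE.psi p v" by (intro exI)
qed (fact UE.cyclic_extension_axioms U_p_group b0_notin_A0)+

lemma U_d_psi: "U_d p m = UE.psi p (d_vec p m)"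
proof -
  have "d_vec p m \<in> Wcarrier p m"
    using p_gt_1 m by (auto simp: d_vec_def Wcarrier_def Wmod_def)
  then have "red (d_vec p m) = d_vec p m" by (rule red_id)
  then show ?thesis unfolding U_psi_p by (simp only: U_d_def d_vec_def)
qed

lemma a0_pow_q: "U_a0 p m [^]\<^bsub>U\<^esub> q \<noteq> \<one>\<^bsub>U\<^esub>"
proof
  assume "U_a0 p m [^]\<^bsub>U\<^esub> q = \<one>\<^bsub>U\<^esub>"
  then have "red (\<lambda>i. int q * unit_vec 0 i) 0 = 0"
    by (simp add: a0_eq W_nat_pow U_one fun_eq_iff del: of_nat_power)
  then have "int p ^ m dvd int p ^ (m - 1)"
    using p_gt_1 by (simp add: red_def unit_vec_def Wmod_def mod_eq_0_iff_dvd)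
  then have "p ^ m dvd q" by (simp flip: of_nat_power)
  then have "m \<le> m - 1" using p_gt_1 power_dvd_imp_le by blast
  then show False using m by simp
qed

end

section \<open>Quotients of U\<close>

text \<open>Every clause is an equation or a membership that homomorphisms preserve. That
  \<open>b\<close> avoids \<open>A\<close> and that a^(p^(m-1)) is nontrivial can be lost, so these
  belong to the later locales.\<close>

lemma cyclic_extension_hom_image:
  assumes "cyclic_extension G A a b p m" and "group_hom G H h"
  shows "cyclic_extension H (h ` A) (h a) (h b) p m"
proof -
  interpret E: cyclic_extension G A a b p m by fact
  interpret h: group_hom G H h by fact
  show ?thesis
  proof (intro cyclic_extension.intro abelian_subgroup.intro abelian_subgroup_axioms.intro
      cyclic_extension_axioms.intro)
    show "subgroup (h ` A) H" by (rule h.subgroup_img_is_subgroup[OF E.A_subgroup])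
    show "h a \<in> h ` A" using E.a_A by blast
    have "h b [^]\<^bsub>H\<^esub> p = h (b [^]\<^bsub>G\<^esub> p)" by (simp add: h.hom_nat_pow)
    then show "h b [^]\<^bsub>H\<^esub> p \<in> h ` A" using E.b_pow_p by simp
    have "h b [^]\<^bsub>H\<^esub> (p ^ (m - 1)) = h (b [^]\<^bsub>G\<^esub> (p ^ (m - 1)))" by (simp add: h.hom_nat_pow)
    then show "h b [^]\<^bsub>H\<^esub> (p ^ (m - 1)) = \<one>\<^bsub>H\<^esub>" by (simp only: E.b_exp h.hom_one)
    have "h a [^]\<^bsub>H\<^esub> (p ^ m) = h (a [^]\<^bsub>G\<^esub> (p ^ m))" using E.a_A by (simp add: h.hom_nat_pow)
    then show "h a [^]\<^bsub>H\<^esub> (p ^ m) = \<one>\<^bsub>H\<^esub>" by (simp only: E.a_exp h.hom_one)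
  next
    fix x y assume "x \<in> h ` A" "y \<in> h ` A"
    then obtain u v where uv: "x = h u" "y = h v" "u \<in> A" "v \<in> A" by blast
    then show "x \<otimes>\<^bsub>H\<^esub> y = y \<otimes>\<^bsub>H\<^esub> x" using E.A_comm[of u v] by (simp flip: h.hom_mult)
  next
    fix x assume "x \<in> h ` A"
    then obtain u where u: "x = h u" "u \<in> A" by blast
    have c: "inv\<^bsub>H\<^esub> (h b) \<otimes>\<^bsub>H\<^esub> x \<otimes>\<^bsub>H\<^esub> h b = h (inv\<^bsub>G\<^esub> b \<otimes>\<^bsub>G\<^esub> u \<otimes>\<^bsub>G\<^esub> b)"
      using u by simp
    then show "inv\<^bsub>H\<^esub> (h b) \<otimes>\<^bsub>H\<^esub> x \<otimes>\<^bsub>H\<^esub> h b \<in> h ` A" using E.conj_A[OF u(2)] by simp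
    have "(inv\<^bsub>H\<^esub> (h b) \<otimes>\<^bsub>H\<^esub> x \<otimes>\<^bsub>H\<^esub> h b \<otimes>\<^bsub>H\<^esub> inv\<^bsub>H\<^esub> x) [^]\<^bsub>H\<^esub> (p ^ (m - 1)) =
        h ((inv\<^bsub>G\<^esub> b \<otimes>\<^bsub>G\<^esub> u \<otimes>\<^bsub>G\<^esub> b \<otimes>\<^bsub>G\<^esub> inv\<^bsub>G\<^esub> u) [^]\<^bsub>G\<^esub> (p ^ (m - 1)))"
      using u by (simp add: h.hom_nat_pow)
    then show "(inv\<^bsub>H\<^esub> (h b) \<otimes>\<^bsub>H\<^esub> x \<otimes>\<^bsub>H\<^esub> h b \<otimes>\<^bsub>H\<^esub> inv\<^bsub>H\<^esub> x) [^]\<^bsub>H\<^esub> (p ^ (m - 1)) = \<one>\<^bsub>H\<^esub>"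
      by (simp only: E.comm_exp[OF u(2)] h.hom_one)
  qed (simp_all add: E.p E.m)
qed

context U_params
begin

text \<open>Each condition on \<open>N\<close> gives one clause: N below the Frattini subgroup,
  hence inside \<open>A0\<close>, keeps the image of \<open>b0\<close> outside that of
  \<open>A0\<close>; trivial intersection with the group of \<open>U_a0 p m\<close> preserves the
  nontrivial power; \<open>U_D\<close> inside \<open>N\<close> gives d = 1; and the condition on the
  derived subgroup gives non-commutativity.\<close>

lemma quotient_critical:
  assumes N: "N \<in> U_NN p m"
  shows "critical_presentation (U Mod N) ((\<lambda>x. N #>\<^bsub>U\<^esub> x) ` A0) (N #>\<^bsub>U\<^esub> U_a0 p m) (N #>\<^bsub>U\<^esub> b0) p m"
    and "\<not> abelian_set (U Mod N) (carrier (U Mod N))"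
proof -
  let ?h = "\<lambda>x. N #>\<^bsub>U\<^esub> x"
  let ?Q = "U Mod N"
  have nN: "N \<lhd> U" and D: "U_D p m \<subseteq> N" and fr: "N \<subseteq> frattini U"
    and int: "N \<inter> generate U {U_a0 p m} = {\<one>\<^bsub>U\<^esub>}"
    and der: "\<not> derived U (carrier U) \<subseteq> N"
    using N unfolding U_NN_def by auto
  interpret N: normal N U by (rule nN)
  interpret h: group_hom U ?Q ?h
    by (intro group_hom.intro group_hom_axioms.intro U_group N.factorgroup_is_group N.r_coset_hom_Mod)
  have a0c: "U_a0 p m \<in> carrier U" using UE.a_A UE.A_carrier by blast
  have ker: "?h x = \<one>\<^bsub>?Q\<^esub> \<longleftrightarrow> x \<in> N" if "x \<in> carrier U" for x
    using that N.rcos_const[OF U_group, of x] U.rcos_self[OF that N.subgroup_axioms] by auto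
  have NA0: "N \<subseteq> A0"
    using fr UP.maximal_A unfolding frattini_def by blast
  show "critical_presentation ?Q (?h ` A0) (?h (U_a0 p m)) (?h b0) p m"
  proof (intro critical_presentation.intro critical_presentation_axioms.intro
      presented_extension.intro presented_extension_axioms.intro)
    show "cyclic_extension ?Q (?h ` A0) (?h (U_a0 p m)) (?h b0) p m"
      by (rule cyclic_extension_hom_image[OF UE.cyclic_extension_axioms h.group_hom_axioms])
    have "card (rcosets\<^bsub>U\<^esub> N) * card N = order U" by (rule U.lagrange[OF N.subgroup_axioms])
    moreover obtain k where "order U = p ^ k" using U_p_group unfolding p_group_def order_def by blast
    ultimately have "card (rcosets\<^bsub>U\<^esub> N) dvd p ^ k" by (metis dvd_triv_left)
    then obtain j where "card (rcosets\<^bsub>U\<^esub> N) = p ^ j" using divides_primepow_nat[OF p] by blast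
    moreover have "finite (rcosets\<^bsub>U\<^esub> N)" using UP.fin by (simp add: RCOSETS_def)
    ultimately show "p_group p ?Q"
      unfolding p_group_def using N.factorgroup_is_group by (auto simp: FactGroup_def)
    show "?h b0 \<notin> ?h ` A0"
    proof
      assume "?h b0 \<in> ?h ` A0"
      then obtain x where x: "x \<in> A0" "?h b0 = ?h x" by blast
      then have "b0 \<in> N #>\<^bsub>U\<^esub> x" using U.rcos_self[OF b0_carrier N.subgroup_axioms] by simp
      then obtain n where n: "n \<in> N" "b0 = n \<otimes>\<^bsub>U\<^esub> x" by (auto simp: r_coset_def)
      have "b0 \<in> A0" unfolding n(2) using NA0 n(1) x(1) by (intro UE.A_mult) auto
      then show False using b0_notin_A0 by simp
    qed
    have psi_h: "?h (UE.psi p v) = pow_prod ?Q (comm_seq ?Q (?h b0) (?h (U_a0 p m))) p v" for v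
    proof -
      have "?h (UE.psi p v) = pow_prod ?Q (\<lambda>i. ?h (UE.c_seq i)) p v"
        using h.hom_pow_prod[of p UE.c_seq v] by blast
      also have "(\<lambda>i. ?h (UE.c_seq i)) = comm_seq ?Q (?h b0) (?h (U_a0 p m))"
        using h.hom_comm_seq[OF a0c b0_carrier] by blast
      finally show ?thesis .
    qed
    show "\<exists>(k::nat) v. y = ?h b0 [^]\<^bsub>?Q\<^esub> k \<otimes>\<^bsub>?Q\<^esub> pow_prod ?Q (comm_seq ?Q (?h b0) (?h (U_a0 p m))) p v"
      if y: "y \<in> carrier ?Q" for y
    proof -
      obtain x where x: "x \<in> carrier U" "y = ?h x" using y by (auto simp: carrier_FactGroup)
      then obtain k :: nat and v where kv: "x = b0 [^]\<^bsub>U\<^esub> k \<otimes>\<^bsub>U\<^esub> UE.psi p v"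
        using UP.gen[OF x(1)] by (elim exE)
      have "y = ?h (b0 [^]\<^bsub>U\<^esub> k) \<otimes>\<^bsub>?Q\<^esub> ?h (UE.psi p v)"
        unfolding x(2) kv using b0_carrier UE.A_carrier[OF UE.psi_A] by (simp only: h.hom_mult U.nat_pow_closed)
      also have "?h (b0 [^]\<^bsub>U\<^esub> k) = ?h b0 [^]\<^bsub>?Q\<^esub> k" by (rule h.hom_nat_pow[OF b0_carrier])
      finally show ?thesis unfolding psi_h by blast
    qed
    show "?h (U_a0 p m) [^]\<^bsub>?Q\<^esub> q \<noteq> \<one>\<^bsub>?Q\<^esub>"
    proof
      assume "?h (U_a0 p m) [^]\<^bsub>?Q\<^esub> q = \<one>\<^bsub>?Q\<^esub>"
      then have "?h (U_a0 p m [^]\<^bsub>U\<^esub> q) = \<one>\<^bsub>?Q\<^esub>" by (simp only: h.hom_nat_pow[OF a0c])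
      then have "U_a0 p m [^]\<^bsub>U\<^esub> q \<in> N" using ker a0c by blast
      moreover have "U_a0 p m [^]\<^bsub>U\<^esub> q \<in> generate U {U_a0 p m}"
        unfolding U.generate_pow[OF a0c] using int_pow_int[of U "U_a0 p m" q] by (metis (mono_tags, lifting) UNIV_I mem_Collect_eq)
      ultimately show False using int a0_pow_q by blast
    qed
    have "U_d p m \<in> N" using D unfolding U_D_def by (auto intro: generate.incl)
    then have "?h (UE.psi p (d_vec p m)) = \<one>\<^bsub>?Q\<^esub>"
      using ker[of "U_d p m"] UE.A_carrier[OF UE.psi_A] by (simp only: U_d_psi)
    then show "pow_prod ?Q (comm_seq ?Q (?h b0) (?h (U_a0 p m))) p (d_vec p m) = \<one>\<^bsub>?Q\<^esub>"
      by (simp only: psi_h)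
  qed
  show "\<not> abelian_set ?Q (carrier ?Q)"
  proof
    assume ab: "abelian_set ?Q (carrier ?Q)"
    have "derived_set U (carrier U) \<subseteq> N"
    proof
      fix z assume "z \<in> derived_set U (carrier U)"
      then obtain x y where xy: "x \<in> carrier U" "y \<in> carrier U"
        "z = x \<otimes>\<^bsub>U\<^esub> y \<otimes>\<^bsub>U\<^esub> inv\<^bsub>U\<^esub> x \<otimes>\<^bsub>U\<^esub> inv\<^bsub>U\<^esub> y" by blast
      have hc: "?h x \<in> carrier ?Q" "?h y \<in> carrier ?Q" using xy h.hom_closed by blast+
      then have c: "?h x \<otimes>\<^bsub>?Q\<^esub> ?h y = ?h y \<otimes>\<^bsub>?Q\<^esub> ?h x" using ab unfolding abelian_set_def by blast
      have "?h z = ?h x \<otimes>\<^bsub>?Q\<^esub> ?h y \<otimes>\<^bsub>?Q\<^esub> inv\<^bsub>?Q\<^esub> ?h x \<otimes>\<^bsub>?Q\<^esub> inv\<^bsub>?Q\<^esub> ?h y"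
        unfolding xy(3) using xy(1,2) by (simp only: h.hom_mult h.hom_inv U.m_closed U.inv_closed)
      also have "\<dots> = \<one>\<^bsub>?Q\<^esub>"
        unfolding c using hc by (simp only: h.H.m_assoc h.H.r_inv h.H.r_one h.H.m_closed h.H.inv_closed h.H.inv_mult_cancel)
      finally have "?h z = \<one>\<^bsub>?Q\<^esub>" .
      moreover have "z \<in> carrier U" unfolding xy(3) using xy(1,2) by simp
      ultimately show "z \<in> N" using ker by blast
    qed
    then have "derived U (carrier U) \<subseteq> N"
      unfolding derived_def by (rule U.generate_subgroup_incl[OF _ N.subgroup_axioms])
    then show False using der by simp
  qed
qed

section \<open>Homomorphisms from U\<close>

lemma Wplus_eq_red: "Wplus p m v w = red (\<lambda>i. v i + w i)"
  by (simp add: Wplus_def red_def)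

text \<open>The map respects the reductions because b^q = 1 and \<open>psi p\<close> depends only on
  residues. It is multiplicative because moving b^l left past a value of \<open>psi p\<close>
  applies \<open>cj\<close> l times, which on exponents is phi^l.\<close>

lemma U_hom:
  assumes "cyclic_extension G A a b p m"
  shows "group_hom U G (\<lambda>x. b [^]\<^bsub>G\<^esub> fst x \<otimes>\<^bsub>G\<^esub> pow_prod G (comm_seq G b a) p (snd x))"
proof -
  interpret E: cyclic_extension G A a b p m by fact
  have psi_red: "E.psi p (red v) = E.psi p v" for v
    by (rule E.psi_mod) (simp add: red_def)
  have psi_phi: "E.psi p ((Wphi p m ^^ n) w) = (E.cj ^^ n) (E.psi p w)" if "w \<in> Wcarrier p m" for n w
  proof (induction n)
    case (Suc n)
    have "(Wphi p m ^^ Suc n) w = red (phi_lift p ((Wphi p m ^^ n) w))"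
      using Wphi_red[of "(Wphi p m ^^ n) w"] red_id[OF Wphi_pow_closed[OF that, of n]] by simp
    then show ?case using Suc by (simp add: psi_red flip: E.cj_psi_phi)
  qed simp
  have b_mod: "b [^]\<^bsub>G\<^esub> (n mod q) = b [^]\<^bsub>G\<^esub> n" for n
  proof -
    have "b [^]\<^bsub>G\<^esub> n = b [^]\<^bsub>G\<^esub> (q * (n div q) + n mod q)" by simp
    also have "\<dots> = (b [^]\<^bsub>G\<^esub> q) [^]\<^bsub>G\<^esub> (n div q) \<otimes>\<^bsub>G\<^esub> b [^]\<^bsub>G\<^esub> (n mod q)"
      by (simp only: E.nat_pow_mult[symmetric] E.nat_pow_pow E.b_carrier)
    finally show ?thesis by (simp only: E.b_exp E.nat_pow_one E.l_one E.nat_pow_closed E.b_carrier)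
  qed
  show ?thesis
  proof (intro group_hom.intro group_hom_axioms.intro U_group E.is_group homI)
    fix x assume "x \<in> carrier U"
    show "b [^]\<^bsub>G\<^esub> fst x \<otimes>\<^bsub>G\<^esub> E.psi p (snd x) \<in> carrier G" by (simp add: E.A_carrier)
  next
    fix x y assume xy: "x \<in> carrier U" "y \<in> carrier U"
    obtain k u l v where eq: "x = (k, u)" "y = (l, v)" by (cases x; cases y)
    have W: "u \<in> Wcarrier p m" "v \<in> Wcarrier p m" using xy eq by (auto simp: U_carrier)
    have cA: "(E.cj ^^ l) (E.psi p u) \<in> carrier G" using E.cj_iter_A[OF E.psi_A] by blast
    have A: "E.psi p w \<in> carrier G" for w by blast
    have "b [^]\<^bsub>G\<^esub> fst (x \<otimes>\<^bsub>U\<^esub> y) \<otimes>\<^bsub>G\<^esub> E.psi p (snd (x \<otimes>\<^bsub>U\<^esub> y)) =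
        b [^]\<^bsub>G\<^esub> (k + l) \<otimes>\<^bsub>G\<^esub> ((E.cj ^^ l) (E.psi p u) \<otimes>\<^bsub>G\<^esub> E.psi p v)"
      using W by (simp only: eq U_mult_eq fst_conv snd_conv b_mod Wplus_eq_red psi_red E.psi_add psi_phi)
    also have "\<dots> = b [^]\<^bsub>G\<^esub> k \<otimes>\<^bsub>G\<^esub> (b [^]\<^bsub>G\<^esub> l \<otimes>\<^bsub>G\<^esub> (E.cj ^^ l) (E.psi p u)) \<otimes>\<^bsub>G\<^esub> E.psi p v"
      using cA A by (simp add: E.m_assoc flip: E.nat_pow_mult)
    also have "b [^]\<^bsub>G\<^esub> l \<otimes>\<^bsub>G\<^esub> (E.cj ^^ l) (E.psi p u) = E.psi p u \<otimes>\<^bsub>G\<^esub> b [^]\<^bsub>G\<^esub> l"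
      by (rule E.mult_b_pow_cj[OF A, symmetric])
    also have "b [^]\<^bsub>G\<^esub> k \<otimes>\<^bsub>G\<^esub> (E.psi p u \<otimes>\<^bsub>G\<^esub> b [^]\<^bsub>G\<^esub> l) \<otimes>\<^bsub>G\<^esub> E.psi p v =
        (b [^]\<^bsub>G\<^esub> fst x \<otimes>\<^bsub>G\<^esub> E.psi p (snd x)) \<otimes>\<^bsub>G\<^esub> (b [^]\<^bsub>G\<^esub> fst y \<otimes>\<^bsub>G\<^esub> E.psi p (snd y))"
      using A by (simp add: eq E.m_assoc)
    finally show "b [^]\<^bsub>G\<^esub> fst (x \<otimes>\<^bsub>U\<^esub> y) \<otimes>\<^bsub>G\<^esub> E.psi p (snd (x \<otimes>\<^bsub>U\<^esub> y)) =
        (b [^]\<^bsub>G\<^esub> fst x \<otimes>\<^bsub>G\<^esub> E.psi p (snd x)) \<otimes>\<^bsub>G\<^esub> (b [^]\<^bsub>G\<^esub> fst y \<otimes>\<^bsub>G\<^esub> E.psi p (snd y))" .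
  qed
qed

end

section \<open>Exponent-critical groups of type A\<close>

text \<open>The cyclic subgroup generated by \<open>x\<close> is abelian and therefore
  proper.\<close>

lemma (in group) maximal_subgroup_containing_element:
  assumes fin: "finite (carrier G)" and nab: "\<not> abelian_set G (carrier G)" and x: "x \<in> carrier G"
  shows "\<exists>M. maximal_subgroup M G \<and> x \<in> M"
proof -
  have "abelian_set G (generate G {x})"
    unfolding abelian_set_def generate_pow[OF x]
  proof safe
    fix k l :: int
    show "x [^] k \<otimes> x [^] l = x [^] l \<otimes> x [^] k" using x by (simp add: add.commute flip: int_pow_mult)
  qed
  then have "generate G {x} \<noteq> carrier G" using nab by auto
  then obtain M where "maximal_subgroup M G" "generate G {x} \<subseteq> M"
    using maximal_subgroup_containing[OF fin generate_is_subgroup] x by blast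
  then show ?thesis using generate.incl[of x "{x}" G] by blast
qed

text \<open>The least common multiple divides p^m and differs from it, so it divides
  p^(m-1).\<close>

lemma (in group) exponent_critical_proper_subgroup:
  assumes p: "Factorial_Ring.prime p" and crit: "exponent_critical G"
    and exp: "grp_exp G (carrier G) = p ^ m"
    and H: "subgroup H G" "H \<noteq> carrier G" "\<not> abelian_set G H" and x: "x \<in> H"
  shows "x [^] (p ^ (m - 1)) = \<one>"
proof -
  let ?S = "{grp_exp G H | H. subgroup H G \<and> H \<noteq> carrier G \<and> \<not> abelian_set G H}"
  have "Lcm ?S dvd p ^ m"
  proof (rule Lcm_least, unfold mem_Collect_eq, elim exE conjE)
    fix e K assume K: "e = grp_exp G K" "subgroup K G"
    show "e dvd p ^ m"
      unfolding K(1) grp_exp_def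
    proof (rule Lcm_least, safe)
      fix y assume "y \<in> K"
      then have "y \<in> carrier G" by (rule subgroup.mem_carrier[OF K(2)])
      then have "ord y dvd grp_exp G (carrier G)" unfolding grp_exp_def by (intro dvd_Lcm imageI)
      then show "ord y dvd p ^ m" by (simp only: exp)
    qed
  qed
  then obtain s where s: "Lcm ?S = p ^ s" "s \<le> m" using divides_primepow_nat[OF p] by blast
  have "p ^ m \<noteq> Lcm ?S" using crit exp unfolding exponent_critical_def by argo
  then have "s \<noteq> m" using s(1) by metis
  then have "s \<le> m - 1" using s by simp
  have "ord x dvd grp_exp G H" unfolding grp_exp_def using x by (intro dvd_Lcm imageI)
  also have "grp_exp G H dvd Lcm ?S" using H by (intro dvd_Lcm) blast
  also have "Lcm ?S dvd p ^ (m - 1)" using s(1) \<open>s \<le> m - 1\<close> by (metis le_imp_power_dvd)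
  finally show ?thesis using pow_eq_id[OF subgroup.mem_carrier[OF H(1) x]] by blast
qed

text \<open>Uniqueness of \<open>A\<close> makes every other maximal subgroup non-abelian, hence
  killed by p^(m-1). So an element \<open>a\<close> of order p^m lies in \<open>A\<close>, and
  \<open>b\<close> can be any element outside \<open>A\<close>. The subgroup \<open>M\<close> serves
  the case of exponent 4.\<close>

lemma (in group) exponent_critical_type_A_generators:
  assumes p: "Factorial_Ring.prime p" and m: "2 \<le> m" and pG: "p_group p G"
    and nab: "\<not> abelian_set G (carrier G)" and crit: "exponent_critical G"
    and exp: "grp_exp G (carrier G) = p ^ m" and tA: "type_A G"
  obtains A a b M where "cyclic_extension G A a b p m" "b \<notin> A" "a [^] (p ^ (m - 1)) \<noteq> \<one>"
    "\<And>x. x \<in> carrier G \<Longrightarrow> x \<notin> A \<Longrightarrow> x [^] (p ^ (m - 1)) = \<one>"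
    "\<And>H. subgroup H G \<Longrightarrow> a \<in> H \<Longrightarrow> b \<in> H \<Longrightarrow> H = carrier G"
    "maximal_subgroup M G" "\<not> abelian_set G M"
proof -
  have fin: "finite (carrier G)" using pG unfolding p_group_def by blast
  obtain A where A: "maximal_subgroup A G" "abelian_set G A"
    and uniq: "\<And>H. maximal_subgroup H G \<Longrightarrow> abelian_set G H \<Longrightarrow> H = A"
    using tA unfolding type_A_def by blast
  have AG: "subgroup A G" "A \<noteq> carrier G" using A unfolding maximal_subgroup_def by auto
  have exp_M: "x [^] (p ^ (m - 1)) = \<one>" if M: "maximal_subgroup M G" "M \<noteq> A" and x: "x \<in> M" for M x
  proof -
    have "\<not> abelian_set G M" using uniq M by blast
    then show ?thesis
      using exponent_critical_proper_subgroup[OF p crit exp _ _ _ x] M unfolding maximal_subgroup_def by blast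
  qed
  have out: "x [^] (p ^ (m - 1)) = \<one>" if x: "x \<in> carrier G" "x \<notin> A" for x
  proof -
    obtain M where "maximal_subgroup M G" "x \<in> M"
      using maximal_subgroup_containing_element[OF fin nab x(1)] by blast
    then show ?thesis using exp_M x by blast
  qed
  have exp_all: "x [^] (p ^ m) = \<one>" if "x \<in> carrier G" for x
  proof -
    have "ord x dvd grp_exp G (carrier G)" unfolding grp_exp_def using that by (intro dvd_Lcm imageI)
    then show ?thesis using that exp by (simp add: pow_eq_id)
  qed
  have "\<exists>a\<in>carrier G. a [^] (p ^ (m - 1)) \<noteq> \<one>"
  proof (rule ccontr)
    assume "\<not> ?thesis"
    then have all: "x [^] (p ^ (m - 1)) = \<one>" if "x \<in> carrier G" for x using that by blast
    have "grp_exp G (carrier G) dvd p ^ (m - 1)"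
      unfolding grp_exp_def by (rule Lcm_least) (use all in \<open>auto simp: pow_eq_id[symmetric]\<close>)
    then have "m \<le> m - 1" using exp prime_gt_1_nat[OF p] power_dvd_imp_le by metis
    then show False using m by simp
  qed
  then obtain a where a: "a \<in> carrier G" "a [^] (p ^ (m - 1)) \<noteq> \<one>" by blast
  have aA: "a \<in> A" using a out by blast
  obtain b where b: "b \<in> carrier G" "b \<notin> A"
    using AG subgroup.subset[OF AG(1)] by blast
  obtain M where M: "maximal_subgroup M G" "b \<in> M"
    using maximal_subgroup_containing_element[OF fin nab b(1)] by blast
  have MA: "M \<noteq> A" using M b by blast
  have "A \<lhd> G" by (rule maximal_subgroup_normal[OF p pG A(1)])
  then interpret A: normal A G .
  have ext: "cyclic_extension G A a b p m"
  proof (intro cyclic_extension.intro abelian_subgroup.intro abelian_subgroup_axioms.intro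
      cyclic_extension_axioms.intro)
    fix x y assume "x \<in> A" "y \<in> A"
    then show "x \<otimes> y = y \<otimes> x" using A(2) unfolding abelian_set_def by blast
  next
    fix x assume x: "x \<in> A"
    show "inv b \<otimes> x \<otimes> b \<in> A" using A.inv_op_closed1[OF b(1) x] .
    have xc: "x \<in> carrier G" using x by (rule subgroup.mem_carrier[OF AG(1)])
    \<comment> \<open>Commutators lie in every maximal subgroup, in particular in the one through
      \<open>b\<close>, which is not \<open>A\<close>.\<close>
    have "inv b \<otimes> x \<otimes> inv (inv b) \<otimes> inv x \<in> M"
      by (rule maximal_subgroup_commutator[OF p pG M(1)]) (use b xc in auto)
    then show "(inv b \<otimes> x \<otimes> b \<otimes> inv x) [^] (p ^ (m - 1)) = \<one>" using exp_M[OF M(1) MA] b by simp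
  next
    show "b [^] p \<in> A" by (rule maximal_subgroup_pow[OF p pG A(1) b(1)])
    show "b [^] (p ^ (m - 1)) = \<one>" by (rule out[OF b])
    show "a [^] (p ^ m) = \<one>" by (rule exp_all[OF a(1)])
  qed (fact is_group AG(1) p m aA b(1))+
  \<comment> \<open>A proper \<open>H\<close> would lie in a maximal subgroup that differs from
    \<open>A\<close> because of \<open>b\<close>, and its exponent would be too small for
    \<open>a\<close>.\<close>
  have gen: "H = carrier G" if H: "subgroup H G" "a \<in> H" "b \<in> H" for H
  proof (rule ccontr)
    assume "H \<noteq> carrier G"
    then obtain K where K: "maximal_subgroup K G" "H \<subseteq> K"
      using maximal_subgroup_containing[OF fin H(1)] by blast
    then have "K \<noteq> A" using H b by blast
    then have "a [^] (p ^ (m - 1)) = \<one>" using exp_M[OF K(1)] K(2) H(2) by blast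
    then show False using a by simp
  qed
  have nabM: "\<not> abelian_set G M" using uniq M MA by blast
  show thesis by (rule that[OF ext b(2) a(2) out gen M(1) nabM])
qed

text \<open>A non-abelian maximal subgroup would be killed by p^(m-1) = 2, but a group of exponent 2
  is abelian.\<close>

lemma no_exponent_critical_type_A_exp_4:
  assumes "p_group 2 P" "\<not> abelian_set P (carrier P)" "exponent_critical P"
    "grp_exp P (carrier P) = 2 ^ 2" "type_A P"
  shows False
proof -
  interpret P: group P using assms(1) unfolding p_group_def by blast
  obtain M where M: "maximal_subgroup M P" "\<not> abelian_set P M"
    by (rule P.exponent_critical_type_A_generators[OF two_is_prime_nat order_refl assms])
  have MG: "subgroup M P" "M \<noteq> carrier P" using M unfolding maximal_subgroup_def by auto
  have invol: "x \<otimes>\<^bsub>P\<^esub> x = \<one>\<^bsub>P\<^esub>" if x: "x \<in> M" for x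
    using P.exponent_critical_proper_subgroup[OF two_is_prime_nat assms(3,4) MG M(2) x]
      subgroup.mem_carrier[OF MG(1) x] by (simp add: numeral_2_eq_2)
  have "abelian_set P M"
    unfolding abelian_set_def
  proof (intro ballI)
    fix x y assume x: "x \<in> M" and y: "y \<in> M"
    have c: "x \<in> carrier P" "y \<in> carrier P" using subgroup.mem_carrier[OF MG(1)] x y by auto
    have xy: "x \<otimes>\<^bsub>P\<^esub> y \<in> M" by (rule subgroup.m_closed[OF MG(1) x y])
    have "inv\<^bsub>P\<^esub> z = z" if "z \<in> M" for z
      using invol[OF that] subgroup.mem_carrier[OF MG(1) that] P.inv_equality by blast
    then show "x \<otimes>\<^bsub>P\<^esub> y = y \<otimes>\<^bsub>P\<^esub> x" using P.inv_mult_group[OF c] x y xy by simp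
  qed
  then show False using M(2) by simp
qed

text \<open>\<open>N\<close> is the kernel of the homomorphism sending the generators of
  \<open>U\<close> to \<open>a\<close> and \<open>b\<close>; it is onto because these generate
  \<open>P\<close>.\<close>

lemma (in U_params) exponent_critical_type_A_iso:
  fixes P :: "('a, 'b) monoid_scheme"
  assumes pP: "p_group p P" and nab: "\<not> abelian_set P (carrier P)" and crit: "exponent_critical P"
    and exp: "grp_exp P (carrier P) = p ^ m" and tA: "type_A P"
  shows "\<exists>N\<in>U_NN p m. P \<cong> U Mod N"
proof -
  interpret P: group P using pP unfolding p_group_def by blast
  obtain A a b where ext: "cyclic_extension P A a b p m" and bA: "b \<notin> A"
    and a_ord: "a [^]\<^bsub>P\<^esub> q \<noteq> \<one>\<^bsub>P\<^esub>"
    and out: "\<And>x. x \<in> carrier P \<Longrightarrow> x \<notin> A \<Longrightarrow> x [^]\<^bsub>P\<^esub> q = \<one>\<^bsub>P\<^esub>"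
    and gen: "\<And>H. subgroup H P \<Longrightarrow> a \<in> H \<Longrightarrow> b \<in> H \<Longrightarrow> H = carrier P"
    by (rule P.exponent_critical_type_A_generators[OF p m pP nab crit exp tA]) blast
  interpret E: cyclic_extension P A a b p m by (rule ext)
  define h :: "nat \<times> (nat \<Rightarrow> int) \<Rightarrow> 'a" where "h = (\<lambda>x. b [^]\<^bsub>P\<^esub> fst x \<otimes>\<^bsub>P\<^esub> E.psi p (snd x))"
  interpret h: group_hom U P h unfolding h_def by (rule U_hom[OF ext])
  have h_W: "h (0, red v) = E.psi p v" for v
  proof -
    have "E.psi p (red v) = E.psi p v" by (rule E.psi_mod) (simp add: red_def)
    then show ?thesis by (simp add: h_def E.A_carrier)
  qed
  have ha: "h (U_a0 p m) = a"
    using E.psi_unit_vec[of 1] E.a_A by (simp add: a0_eq h_W unit_vec_def)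
  have hb: "h b0 = b" by (simp add: h_def b0_def)
  have a0c: "U_a0 p m \<in> carrier U" using UE.a_A UE.A_carrier by blast
  have surj: "h ` carrier U = carrier P"
  proof (rule gen)
    show "subgroup (h ` carrier U) P" by (rule h.img_is_subgroup)
    show "a \<in> h ` carrier U" using ha a0c by blast
    show "b \<in> h ` carrier U" using hb b0_carrier by blast
  qed
  define N where "N = kernel U P h"
  have NI: "x \<in> N \<longleftrightarrow> x \<in> carrier U \<and> h x = \<one>\<^bsub>P\<^esub>" for x
    unfolding N_def kernel_def by blast
  have nN: "N \<lhd> U" unfolding N_def by (rule h.normal_kernel)
  have D: "U_D p m \<subseteq> N"
  proof -
    \<comment> \<open>Being outside \<open>A\<close>, b a is killed by p^(m-1), and by
      \<open>ba_pow\<close> this power is the image of \<open>U_d p m\<close>.\<close>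
    have "b \<otimes>\<^bsub>P\<^esub> a \<notin> A"
    proof
      assume "b \<otimes>\<^bsub>P\<^esub> a \<in> A"
      then have "b \<otimes>\<^bsub>P\<^esub> a \<otimes>\<^bsub>P\<^esub> inv\<^bsub>P\<^esub> a \<in> A" using E.a_A by blast
      then show False using bA E.a_A by (simp add: P.m_assoc)
    qed
    then have "(b \<otimes>\<^bsub>P\<^esub> a) [^]\<^bsub>P\<^esub> q = \<one>\<^bsub>P\<^esub>" using out E.a_A by simp
    then have "h (U_d p m) = \<one>\<^bsub>P\<^esub>" by (simp only: U_d_psi U_psi_p h_W E.ba_pow)
    moreover have "U_d p m \<in> carrier U" by (simp only: U_d_psi U_psi_p W_carrier)
    ultimately have "{U_d p m} \<subseteq> N" using NI by blast
    then show ?thesis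
      unfolding U_D_def by (rule U.generate_subgroup_incl[OF _ normal_imp_subgroup[OF nN]])
  qed
  \<comment> \<open>The element a^q has order \<open>p\<close>.\<close>
  have exp_div: "int p dvd k" if k: "a [^]\<^bsub>P\<^esub> (k * int q) = \<one>\<^bsub>P\<^esub>" for k :: int
  proof -
    have ac: "a \<in> carrier P" using E.a_A by blast
    let ?T = "{\<one>\<^bsub>P\<^esub>}"
    have T: "subgroup ?T P" by (rule P.triv_subgroup)
    let ?c = "a [^]\<^bsub>P\<^esub> q"
    have "?c [^]\<^bsub>P\<^esub> p = \<one>\<^bsub>P\<^esub>"
      using E.a_exp ac m by (simp only: P.nat_pow_pow) (metis One_nat_def Suc_pred' less_le_trans pos2 power_Suc2)
    moreover have "?c [^]\<^bsub>P\<^esub> k = \<one>\<^bsub>P\<^esub>"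
      using k ac P.int_pow_pow[of a "int q" k] by (simp only: int_pow_int mult.commute)
    ultimately show ?thesis
      using P.mem_subgroup_if_prime_pow[OF T _ p, of ?c k] ac a_ord by auto
  qed
  \<comment> \<open>The homomorphism is injective on the powers of \<open>U_a0 p m\<close>: the
    order of this element divides p^m, which is the order of its image \<open>a\<close>.\<close>
  have int: "N \<inter> generate U {U_a0 p m} = {\<one>\<^bsub>U\<^esub>}"
  proof -
    have "x = \<one>\<^bsub>U\<^esub>" if x: "x \<in> N" "x \<in> generate U {U_a0 p m}" for x
    proof -
      obtain k :: int where k: "x = U_a0 p m [^]\<^bsub>U\<^esub> k" using x(2) unfolding U.generate_pow[OF a0c] by blast
      have "h x = a [^]\<^bsub>P\<^esub> k" unfolding k h.hom_int_pow[OF a0c] ha ..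
      moreover have "h x = \<one>\<^bsub>P\<^esub>" using x(1) NI by blast
      ultimately have ak: "a [^]\<^bsub>P\<^esub> k = \<one>\<^bsub>P\<^esub>" by simp
      have ac: "a \<in> carrier P" using E.a_A by blast
      have "int (P.ord a) dvd k" using ak ac by (simp add: P.int_pow_eq_id)
      moreover have "P.ord a = p ^ m"
      proof -
        have "P.ord a dvd p ^ m" using E.a_exp ac by (simp add: P.pow_eq_id)
        then obtain s where s: "P.ord a = p ^ s" "s \<le> m" using divides_primepow_nat[OF p] by blast
        have "\<not> s \<le> m - 1"
        proof
          assume "s \<le> m - 1"
          then have "P.ord a dvd q" using s by (metis le_imp_power_dvd)
          then show False using a_ord P.pow_eq_id[OF ac] by blast
        qed
        then have "s = m" using s by simp
        then show ?thesis using s by simp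
      qed
      moreover have "U.ord (U_a0 p m) dvd p ^ m" using UE.a_exp a0c by (simp add: U.pow_eq_id)
      ultimately have "int (U.ord (U_a0 p m)) dvd k" by (metis dvd_trans of_nat_dvd_iff)
      then show ?thesis using k a0c by (simp add: U.int_pow_eq_id)
    qed
    moreover have "\<one>\<^bsub>U\<^esub> \<in> N \<inter> generate U {U_a0 p m}"
      using NI by (intro IntI generate.one) simp_all
    ultimately show ?thesis by blast
  qed
  have der: "\<not> derived U (carrier U) \<subseteq> N"
  proof
    assume sub: "derived U (carrier U) \<subseteq> N"
    have "abelian_set P (carrier P)"
      unfolding abelian_set_def
    proof (intro ballI)
      fix x y assume xy: "x \<in> carrier P" "y \<in> carrier P"
      have "x \<in> h ` carrier U" "y \<in> h ` carrier U" using xy by (simp_all only: surj)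
      then obtain u v where uv: "u \<in> carrier U" "v \<in> carrier U" "x = h u" "y = h v"
        by (elim imageE)
      have "u \<otimes>\<^bsub>U\<^esub> v \<otimes>\<^bsub>U\<^esub> inv\<^bsub>U\<^esub> u \<otimes>\<^bsub>U\<^esub> inv\<^bsub>U\<^esub> v \<in> derived U (carrier U)"
        unfolding derived_def using uv(1,2) by (intro generate.incl) blast
      then have "u \<otimes>\<^bsub>U\<^esub> v \<otimes>\<^bsub>U\<^esub> inv\<^bsub>U\<^esub> u \<otimes>\<^bsub>U\<^esub> inv\<^bsub>U\<^esub> v \<in> N" using sub by (rule rev_subsetD)
      then have "h (u \<otimes>\<^bsub>U\<^esub> v \<otimes>\<^bsub>U\<^esub> inv\<^bsub>U\<^esub> u \<otimes>\<^bsub>U\<^esub> inv\<^bsub>U\<^esub> v) = \<one>\<^bsub>P\<^esub>" using NI by blast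
      then have "x \<otimes>\<^bsub>P\<^esub> y \<otimes>\<^bsub>P\<^esub> inv\<^bsub>P\<^esub> x \<otimes>\<^bsub>P\<^esub> inv\<^bsub>P\<^esub> y = \<one>\<^bsub>P\<^esub>" using uv by simp
      then have "x \<otimes>\<^bsub>P\<^esub> y \<otimes>\<^bsub>P\<^esub> inv\<^bsub>P\<^esub> (y \<otimes>\<^bsub>P\<^esub> x) = \<one>\<^bsub>P\<^esub>"
        using xy by (simp add: P.inv_mult_group P.m_assoc)
      then show "x \<otimes>\<^bsub>P\<^esub> y = y \<otimes>\<^bsub>P\<^esub> x" using xy P.inv_equality[of "x \<otimes>\<^bsub>P\<^esub> y" "inv\<^bsub>P\<^esub> (y \<otimes>\<^bsub>P\<^esub> x)"] by simp
    qed
    then show False using nab by simp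
  qed
  \<comment> \<open>If b^k times \<open>E.psi p w\<close> is trivial, then b^k lies in
    \<open>A\<close>, so \<open>p\<close> divides k; the \<open>q\<close>-th power then leaves
    a^(w_0 q) = 1, so \<open>p\<close> divides w_0. Hence the element of \<open>U\<close> is a
    product of powers of \<open>p\<close>-th powers and of commutators.\<close>
  have fr: "N \<subseteq> frattini U"
  proof
    fix x assume x: "x \<in> N"
    have xc: "x \<in> carrier U" using x NI by blast
    obtain k w where kw: "x = (k, w)" by (cases x)
    have "h x = \<one>\<^bsub>P\<^esub>" using x NI by blast
    then have one: "b [^]\<^bsub>P\<^esub> k \<otimes>\<^bsub>P\<^esub> E.psi p w = \<one>\<^bsub>P\<^esub>" using kw by (simp add: h_def)
    have psiA: "E.psi p w \<in> A" by (rule E.psi_A)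
    have bk: "b [^]\<^bsub>P\<^esub> k = inv\<^bsub>P\<^esub> E.psi p w"
      using one P.inv_equality[of "b [^]\<^bsub>P\<^esub> k" "E.psi p w"] psiA by (simp add: E.A_carrier)
    then have "b [^]\<^bsub>P\<^esub> k \<in> A" using psiA by (simp add: E.A_inv)
    then have pk: "p dvd k"
      using bA P.mem_subgroup_if_prime_pow[OF E.A_subgroup E.b_carrier p E.b_pow_p, of "int k"]
      by (auto simp: int_pow_int)
    have "inv\<^bsub>P\<^esub> E.psi p w [^]\<^bsub>P\<^esub> q = \<one>\<^bsub>P\<^esub>" using E.b_pow_dvd_exp[OF pk] bk by simp
    then have "E.psi p w [^]\<^bsub>P\<^esub> q = \<one>\<^bsub>P\<^esub>"
      using psiA P.nat_pow_inv[of "E.psi p w" q] by (simp add: E.A_carrier)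
    then have "a [^]\<^bsub>P\<^esub> (w 0 * int q) = \<one>\<^bsub>P\<^esub>" by (simp only: E.psi_exp)
    then have w0: "int p dvd w 0" by (rule exp_div)
    show "x \<in> frattini U"
      unfolding frattini_def
    proof (intro IntI xc InterI)
      fix M assume "M \<in> {H. maximal_subgroup H U}"
      then have M: "maximal_subgroup M U" by blast
      then have MU: "subgroup M U" unfolding maximal_subgroup_def by blast
      have dvd_pow: "z [^]\<^bsub>U\<^esub> j \<in> M" if z: "z \<in> carrier U" and j: "int p dvd j" for z and j :: int
      proof -
        obtain t where "j = int p * t" using j by blast
        then have "z [^]\<^bsub>U\<^esub> j = (z [^]\<^bsub>U\<^esub> p) [^]\<^bsub>U\<^esub> t"
          using z by (simp add: int_pow_int flip: U.int_pow_pow)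
        then show ?thesis
          using U.subgroup_int_pow_closed[OF MU U.maximal_subgroup_pow[OF p U_p_group M z]] by simp
      qed
      have "b0 [^]\<^bsub>U\<^esub> k \<in> M" using dvd_pow[OF b0_carrier, of "int k"] pk by (simp add: int_pow_int)
      moreover have "U_a0 p m [^]\<^bsub>U\<^esub> w 0 \<in> M" by (rule dvd_pow[OF a0c w0])
      then have "UE.psi p w \<in> M"
        unfolding UE.psi_split by (intro subgroup.m_closed[OF MU] UE.pow_prod_in MU UP.c_seq_in_maximal M)
      ultimately have "b0 [^]\<^bsub>U\<^esub> k \<otimes>\<^bsub>U\<^esub> UE.psi p w \<in> M" by (rule subgroup.m_closed[OF MU])
      then show "x \<in> M" using U_gen[of k w] xc kw by simp
    qed
  qed
  have "N \<in> U_NN p m" unfolding U_NN_def using nN D fr int der by blast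
  moreover have "P \<cong> U Mod N"
  proof -
    have "U Mod N \<cong> P" unfolding N_def by (rule h.FactGroup_iso[OF surj])
    then show ?thesis by (rule group.iso_sym[OF normal.factorgroup_is_group[OF nN]])
  qed
  ultimately show ?thesis by blast
qed

theorem theoremE:
  fixes p m :: nat
  assumes "Factorial_Ring.prime p" and "m \<ge> 2"
  shows
    "(\<forall>P :: ('a, 'b) monoid_scheme.
        p_group p P \<and> \<not> abelian_set P (carrier P) \<and> exponent_critical P
        \<and> grp_exp P (carrier P) = p ^ m \<and> type_A P
        \<longrightarrow> (\<exists>N\<in>U_NN p m. P \<cong> U_grp p m Mod N))
   \<and> (\<forall>N\<in>U_NN p m.
        p_group p (U_grp p m Mod N) \<and> \<not> abelian_set (U_grp p m Mod N) (carrier (U_grp p m Mod N))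
        \<and> exponent_critical (U_grp p m Mod N)
        \<and> grp_exp (U_grp p m Mod N) (carrier (U_grp p m Mod N)) = p ^ m)
   \<and> (p = 2 \<and> m = 2 \<longrightarrow>
        \<not> (\<exists>P :: ('a, 'b) monoid_scheme.
             p_group p P \<and> \<not> abelian_set P (carrier P) \<and> exponent_critical P
             \<and> grp_exp P (carrier P) = p ^ m \<and> type_A P))
   \<and> (odd p \<or> m \<ge> 3 \<longrightarrow>
        (\<forall>N\<in>U_NN p m.
           p_group p (U_grp p m Mod N) \<and> exponent_critical (U_grp p m Mod N)
           \<and> grp_exp (U_grp p m Mod N) (carrier (U_grp p m Mod N)) = p ^ m
           \<and> type_A (U_grp p m Mod N)))"
proof -
  interpret U_params p m using assms by unfold_locales
  have quot: "p_group p (U Mod N) \<and> \<not> abelian_set (U Mod N) (carrier (U Mod N))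
        \<and> exponent_critical (U Mod N) \<and> grp_exp (U Mod N) (carrier (U Mod N)) = p ^ m"
    if N: "N \<in> U_NN p m" for N
  proof -
    interpret Q: critical_presentation "U Mod N" "(\<lambda>x. N #>\<^bsub>U\<^esub> x) ` A0" "N #>\<^bsub>U\<^esub> U_a0 p m" "N #>\<^bsub>U\<^esub> b0" p m
      by (rule quotient_critical(1)[OF N])
    show ?thesis
      by (intro conjI Q.pG quotient_critical(2)[OF N] Q.exponent_critical_G Q.grp_exp_carrier)
  qed
  have quot_A: "type_A (U Mod N)" if N: "N \<in> U_NN p m" and "odd p \<or> m \<ge> 3" for N
    by (rule critical_presentation.type_A_G[OF quotient_critical(1)[OF N] that(2)])
  show ?thesis
  proof (intro conjI allI ballI impI notI)
    fix P :: "('a, 'b) monoid_scheme"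
    assume "p_group p P \<and> \<not> abelian_set P (carrier P) \<and> exponent_critical P
        \<and> grp_exp P (carrier P) = p ^ m \<and> type_A P"
    then show "\<exists>N\<in>U_NN p m. P \<cong> U Mod N" by (elim conjE) (rule exponent_critical_type_A_iso)
  next
    assume 2: "p = 2 \<and> m = 2"
    assume "\<exists>P :: ('a, 'b) monoid_scheme. p_group p P \<and> \<not> abelian_set P (carrier P) \<and> exponent_critical P
        \<and> grp_exp P (carrier P) = p ^ m \<and> type_A P"
    then obtain P :: "('a, 'b) monoid_scheme" where "p_group 2 P" "\<not> abelian_set P (carrier P)"
      "exponent_critical P" "grp_exp P (carrier P) = 2 ^ 2" "type_A P"
      using 2 by blast
    then show False by (rule no_exponent_critical_type_A_exp_4)
  qed (use quot quot_A in blast)+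
qed

end
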